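(* Let $q$ be an odd prime power, let $n\ge1$ and $0\le k\le n$, and let $\psi\in\{+,-\}$ (identified with $\pm1$ when used as a factor). If $r\ge 1$ is odd, define $t=0$ if $(-1)^{(r+1)/2}$ is a square in $\mathbf{F}_q$ and $t=1$ otherwise. Then $$\mathrm{sym}_0^{\psi}(n+1,k+1,r+1)=\frac1q\,\mathrm{sym}_0^{\psi}(n+1,k,r+1)+(-1)^t\cdot\psi\cdot\left(\frac12\,\mathrm{sym}_0(n,k,r)+\mathrm{sym}_0^{\psi}(n,k,r+1)\right)\bigl(q^{(r+1)/2}-q^{(r-1)/2}\bigr).$$ If $r$ is even and $r>0$, define $t=0$ if $(-1)^{r/2}$ is a square in $\mathbf{F}_q$ and $t=1$ otherwise. Then $$\mathrm{sym}_0^{\psi}(n+1,k+1,r+1)=\frac1q\,\mathrm{sym}_0^{\psi}(n+1,k,r+1)-\frac{(-1)^t}{2}\bigl(\mathrm{sym}_0^{+}(n,k,r)-\mathrm{sym}_0^{-}(n,k,r)\bigr)\bigl(q^{r/2}-q^{r/2-1}\bigr).$$ The initial values are $$\mathrm{sym}_0^{\psi}(n+1,k+1,1)=\frac12\,\mathrm{sym}_0(n+1,k+1,1)=\frac{q-1}{2}\sum_{i=0}^{n-k-1}q^i=\frac{q^{n-k}-1}{2},$$ and, for $s\ge0$, $$\mathrm{sym}_0^{+}(n,0,2s+1)=\frac12\,\mathrm{sym}(n,2s+1),\qquad \mathrm{sym}_0^{+}(n,0,2s)=\frac12\cdot\frac{q^s+(\psi(-1))^s}{q^s}\,\mathrm{sym}(n,2s),$$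 where $\psi(-1)=+1$ if $-1$ is a square in $\mathbf{F}_q$ and $-1$ otherwise.
   Context: $\mathbf{F}_q$ is the field with $q$ elements. For $\delta\in\mathbf{F}_q^\times$, $\psi(\delta)=+$ if $\delta$ is a square in $\mathbf{F}_q$ and $\psi(\delta)=-$ otherwise. Every symmetric $n\times n$ matrix $A$ over $\mathbf{F}_q$ of rank $r>0$ can be written as $A=M\cdot\mathrm{diag}(1^{r-1},\delta,0^{n-r})\cdot M^T$ with $M\in\mathbf{GL}(n,q)$ and $\delta\in\mathbf{F}_q^\times$ either $1$ or a non-square; the (quadratic) character of $A$ is $\psi(A)=+$ if $\delta=1$ and $\psi(A)=-$ if $\delta$ is a non-square. By convention the zero matrix has character $+$. $\mathrm{sym}(n,r)$ is the number of $n\times n$ symmetric matrices over $\mathbf{F}_q$ of rank $r$. $\mathrm{sym}_0(n,k,r)$ is the number of $n\times n$ symmetric matrices over $\mathbf{F}_q$ of rank $r$ whose first $k$ diagonal entries equal $0$ (no other restrictions), and $\mathrm{sym}_0^{\psi}(n,k,r)$ counts only those among them that have character $\psi$. *)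

theory Defs
  imports
    Complex_Main
    "HOL-Library.Cardinality"
    "HOL-Computational_Algebra.Nth_Powers"
    "Jordan_Normal_Form.DL_Rank"
begin

definition quad_char :: "'a::field \<Rightarrow> int" where
  "quad_char \<delta> = (if is_square \<delta> then 1 else - 1)"

definition sym_mat :: "nat \<Rightarrow> 'a::field mat \<Rightarrow> bool" where
  "sym_mat n A \<longleftrightarrow> A \<in> carrier_mat n n \<and> transpose_mat A = A"

text \<open>The signs \<open>+\<close> and \<open>-\<close> are the integers \<open>1\<close> and \<open>-1\<close>. A matrix of rank
  \<open>r > 0\<close> has character \<open>\<psi>(\<delta>)\<close> if it is congruent to \<open>diag(1,\<dots>,1,\<delta>,0,\<dots>,0)\<close>
  (\<open>r - 1\<close> ones), where \<open>\<delta>\<close> is \<open>1\<close> or a non-square. The character is a relation here: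
  that a symmetric matrix over a finite field of odd characteristic has exactly one is
  a theorem.\<close>

definition has_character :: "nat \<Rightarrow> 'a::field mat \<Rightarrow> int \<Rightarrow> bool" where
  "has_character n A \<psi> \<longleftrightarrow>
     (let r = vec_space.rank n A in
      if A = 0\<^sub>m n n then \<psi> = 1
      else \<exists>M \<delta>. M \<in> carrier_mat n n \<and> invertible_mat M \<and>
             \<delta> \<noteq> 0 \<and> (\<delta> = 1 \<or> \<not> is_square \<delta>) \<and>
             A = M * mk_diagonal (replicate (r - 1) 1 @ [\<delta>] @ replicate (n - r) 0) * transpose_mat M \<and>
             \<psi> = quad_char \<delta>)"

definition sym_num :: "'a::field itself \<Rightarrow> nat \<Rightarrow> nat \<Rightarrow> nat" where
  "sym_num _ n r = card {A :: 'a mat. sym_mat n A \<and> vec_space.rank n A = r}"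

text \<open>Matrix indices start at \<open>0\<close>, so the first \<open>k\<close> diagonal entries are those at \<open>i < k\<close>.
  The counts are only meant for \<open>k \<le> n\<close>.\<close>

definition sym0 :: "'a::field itself \<Rightarrow> nat \<Rightarrow> nat \<Rightarrow> nat \<Rightarrow> nat" where
  "sym0 _ n k r =
     card {A :: 'a mat. sym_mat n A \<and> vec_space.rank n A = r \<and> (\<forall>i<k. A $$ (i, i) = 0)}"

definition sym0_char :: "'a::field itself \<Rightarrow> int \<Rightarrow> nat \<Rightarrow> nat \<Rightarrow> nat \<Rightarrow> nat" where
  "sym0_char _ \<psi> n k r =
     card {A :: 'a mat. sym_mat n A \<and> vec_space.rank n A = r \<and> (\<forall>i<k. A $$ (i, i) = 0) \<and>
                        has_character n A \<psi>}"

end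

theory Submission
  imports Defs
begin

text \<open>
  The last row and column of a symmetric \<open>(n + 1) \<times> (n + 1)\<close> matrix make it a \<^emph>\<open>border\<close> of its
  leading \<open>n \<times> n\<close> block \<open>A\<close>, by a vector \<open>v\<close> and a corner entry \<open>a\<close>. All recursions come from
  fixing \<open>A\<close> and asking how rank and character of the border depend on \<open>v\<close> and \<open>a\<close>. Let \<open>A\<close> have
  rank \<open>r\<close> and character \<open>\<psi>\<close>.

  \<^item> If \<open>v\<close> is not in the column space of \<open>A\<close>, the border splits off a hyperbolic plane: it has rank
    \<open>r + 2\<close> and character \<open>\<psi> \<cdot> \<psi>(-1)\<close>, whatever \<open>a\<close> is (\<open>form_type_border_off_range\<close>).
  \<^item> If \<open>v = A w\<close>, the border is congruent to \<open>A \<oplus> (c)\<close> with \<open>c = a - w\<^sup>T A w\<close>. It has the type of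
    \<open>A\<close> if \<open>c = 0\<close>, and rank \<open>r + 1\<close> and character \<open>\<psi> \<cdot> \<psi>(c)\<close> otherwise
    (\<open>form_type_border_in_range\<close>).

  In coordinates that diagonalize \<open>A\<close>, \<open>w\<^sup>T A w\<close> is a diagonal quadratic form in \<open>r\<close> variables with
  the same discriminant class as \<open>A\<close>. So the number of borders of each type is given by the classical
  numbers of representations of field elements by quadratic forms (\<open>repnum_formula\<close>), whose
  error terms carry the sign \<open>(-1)\<^sup>t\<close>. If \<open>a\<close> ranges over the whole field, the error terms cancel;
  if \<open>a = 0\<close> is required, they survive, and
  \<open>q \<cdot> #{v. a = 0} - #{(v, a)}\<close> is \<open>q\<close> times the contribution of \<open>A\<close> to the correction term in the
  two recursions (\<open>border_fibre\<close>). A simultaneous permutation of rows and columns moves the additional zero of the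
  diagonal to the last position, where the border argument applies (\<open>type_count_swap\<close>).

  The same count over all \<open>(v, a)\<close> gives recursions in \<open>n\<close> for the number of all symmetric matrices of
  given rank and character, from which the initial values follow by induction
  (\<open>type_count_rank_1\<close>, \<open>type_count_parity\<close>).

  All of this presupposes that rank and character can be read off any diagonalization. The rank is
  the number of nonzero diagonal entries (\<open>diagonalizes_rank\<close>). For the character, representation
  numbers help again: they are congruence invariants, and for given rank they determine the product
  of the quadratic characters of the nonzero diagonal entries (\<open>diagonalizes_unique\<close>).
\<close>

section \<open>The quadratic character of a finite field\<close>

text \<open>The quadratic character in its usual extension by \<open>0\<close> at \<open>0\<close>, which makes it multiplicative
  and turns the counts below into character sums.\<close>

definition qchar :: "'a::field \<Rightarrow> int" where
  "qchar x = (if x = 0 then 0 else quad_char x)"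

lemma is_square_iff: "is_square (x :: 'a::field) \<longleftrightarrow> (\<exists>y. x = y\<^sup>2)"
  by (auto simp: is_nth_power_def)

lemma qchar_0 [simp]: "qchar 0 = 0"
  by (simp add: qchar_def)

lemma qchar_cases: "x \<noteq> 0 \<Longrightarrow> qchar x = 1 \<or> qchar x = - 1"
  by (simp add: qchar_def quad_char_def)

lemma qchar_eq_0_iff [simp]: "qchar x = 0 \<longleftrightarrow> x = 0"
  using qchar_cases[of x] by (cases "x = 0") auto

lemma qchar_square_self: "x \<noteq> 0 \<Longrightarrow> qchar x * qchar x = 1"
  using qchar_cases[of x] by auto

lemma qchar_square [simp]: "y \<noteq> 0 \<Longrightarrow> qchar (y\<^sup>2) = 1"
  by (auto simp: qchar_def quad_char_def is_square_iff)

lemma qchar_1 [simp]: "qchar 1 = 1"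
  using qchar_square[of 1] by simp

text \<open>The field is given by its type; the parameter lets an interpretation name that type.\<close>

locale odd_finite_field =
  fixes base_field :: "'a::{field,finite} itself"
  assumes odd_card: "odd CARD('a)"
begin

lemma two_neq_zero: "(2::'a) \<noteq> 0"
proof
  assume two: "(2::'a) = 0"
  have "(\<Sum>x\<in>UNIV. x + 1) = (\<Sum>x\<in>UNIV. x :: 'a)"
    by (rule sum.reindex_bij_witness[of _ "\<lambda>x. x - 1" "\<lambda>x. x + 1"]) auto
  then have "of_nat CARD('a) = (0::'a)"
    by (simp add: sum.distrib)
  moreover obtain m where "CARD('a) = 2 * m + 1"
    using odd_card by (rule oddE)
  ultimately show False
    using two by simp
qed

text \<open>The source of every character sum: a nonzero square has the two distinct roots \<open>z\<close> and \<open>- z\<close>.\<close>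

lemma card_square_roots: "int (card {y::'a. y\<^sup>2 = c}) = 1 + qchar c"
proof (cases "c = 0")
  case True
  then show ?thesis by simp
next
  case c: False
  show ?thesis
  proof (cases "is_square c")
    case True
    then obtain z where z: "c = z\<^sup>2"
      by (auto simp: is_square_iff)
    with c have "z \<noteq> 0" by auto
    then have "z + z \<noteq> 0"
      using two_neq_zero by (metis mult_2 mult_eq_0_iff)
    then have "z \<noteq> - z"
      by (metis add.right_inverse)
    moreover have "{y. y\<^sup>2 = c} = {z, - z}"
      using z by (auto simp: power2_eq_iff)
    ultimately have "card {y. y\<^sup>2 = c} = 2" by simp
    with True c show ?thesis
      by (simp add: qchar_def quad_char_def)
  next
    case False
    then have none: "{y. y\<^sup>2 = c} = {}" by (auto simp: is_square_iff)
    show ?thesis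
      unfolding none using False c by (simp add: qchar_def quad_char_def)
  qed
qed

text \<open>Every field element has exactly one square, so summing \<open>card_square_roots\<close> over all values
  counts the field once.\<close>

lemma sum_qchar: "(\<Sum>x\<in>UNIV. qchar (x::'a)) = 0"
proof -
  have "int (card (UNIV::'a set)) = (\<Sum>c\<in>UNIV. int (card {y::'a. y\<^sup>2 = c}))"
    by (subst card_eq_sum, subst sum.image_gen[of UNIV _ "\<lambda>y. y\<^sup>2"])
       (auto intro!: sum.mono_neutral_left simp: image_def)
  also have "\<dots> = int CARD('a) + (\<Sum>x\<in>UNIV. qchar (x::'a))"
    by (simp add: card_square_roots sum.distrib)
  finally show ?thesis by simp
qed

lemma card_qchar_eq:
  assumes "s = 1 \<or> s = - 1"
  shows "2 * int (card {x::'a. qchar x = s}) = int CARD('a) - 1"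
proof -
  let ?P = "{x::'a. qchar x = 1}" and ?N = "{x::'a. qchar x = - 1}"
  have UN: "UNIV = insert 0 (?P \<union> ?N)"
    using qchar_cases by auto
  have "card (UNIV::'a set) = 1 + (card ?P + card ?N)"
    by (subst UN, subst card_insert_disjoint, simp, simp, subst card_Un_disjoint) auto
  moreover have "(\<Sum>x\<in>UNIV. qchar (x::'a)) = int (card ?P) - int (card ?N)"
  proof -
    have "(\<Sum>x\<in>UNIV. qchar (x::'a)) = (\<Sum>x\<in>?P \<union> ?N. qchar x)"
      by (rule sum.mono_neutral_right) (use qchar_cases in auto)
    also have "\<dots> = (\<Sum>x\<in>?P. qchar x) + (\<Sum>x\<in>?N. qchar x)"
      by (rule sum.union_disjoint) auto
    finally show ?thesis by simp
  qed
  ultimately show ?thesis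
    using assms sum_qchar by auto
qed

text \<open>The case that uses the finiteness of the field is that of two non-squares. There are as many
  nonzero squares as non-squares, so multiplication by a non-square \<open>x\<close> maps the former \<^emph>\<open>onto\<close> the
  latter; any other non-square is therefore a square times \<open>x\<close>.\<close>

lemma qchar_mult: "qchar (x * y) = qchar x * qchar (y::'a)"
proof (cases "x = 0 \<or> y = 0")
  case True
  then show ?thesis by auto
next
  case False
  then have x: "x \<noteq> 0" and y: "y \<noteq> 0" by auto
  have square_mult: "qchar (u * v) = qchar v" if "qchar u = 1" for u v :: 'a
  proof -
    from that have "u \<noteq> 0" "is_square u"
      by (auto simp: qchar_def quad_char_def split: if_splits)
    then obtain z where z: "u = z\<^sup>2" "z \<noteq> 0"
      by (auto simp: is_square_iff)
    have "is_square (z\<^sup>2 * v) \<longleftrightarrow> is_square v"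
    proof
      assume "is_square (z\<^sup>2 * v)"
      then obtain w where "z\<^sup>2 * v = w\<^sup>2" by (auto simp: is_square_iff)
      then have "v = (w / z)\<^sup>2"
        using z by (simp add: field_simps)
      then show "is_square v" by (auto simp: is_square_iff)
    qed (auto simp: is_square_iff simp flip: power_mult_distrib)
    then show ?thesis
      using z by (simp add: qchar_def quad_char_def)
  qed
  show ?thesis
  proof (cases "qchar x = 1")
    case True
    then show ?thesis by (simp add: square_mult)
  next
    case nonsq: False
    let ?P = "{x::'a. qchar x = 1}" and ?N = "{x::'a. qchar x = - 1}"
    have x': "qchar x = - 1"
      using nonsq qchar_cases[OF x] by auto
    have "(\<lambda>u. u * x) ` ?P = ?N"
    proof (rule card_subset_eq)
      show "(\<lambda>u. u * x) ` ?P \<subseteq> ?N"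
        using square_mult x' by auto
      have "card ((\<lambda>u. u * x) ` ?P) = card ?P"
        using x by (auto intro!: card_image inj_onI)
      then show "card ((\<lambda>u. u * x) ` ?P) = card ?N"
        using card_qchar_eq[of 1] card_qchar_eq[of "- 1"] by simp
    qed simp
    show ?thesis
    proof (cases "qchar y = 1")
      case True
      then show ?thesis by (metis mult.commute mult_1 square_mult)
    next
      case False
      then have y': "qchar y = - 1" using qchar_cases[OF y] by auto
      then obtain u where u: "qchar u = 1" "y = u * x"
        using \<open>(\<lambda>u. u * x) ` ?P = ?N\<close> by blast
      have "x * y = u * x\<^sup>2"
        unfolding u(2) power2_eq_square by (simp only: mult_ac)
      then show ?thesis
        using u(1) x x' y' by (simp add: square_mult)
    qed
  qed
qed

lemma qchar_power: "qchar ((x::'a) ^ n) = qchar x ^ n"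
  by (induction n) (simp_all add: qchar_mult)

lemma qchar_inverse: "qchar (inverse (x::'a)) = qchar x"
proof (cases "x = 0")
  case False
  then have "qchar (inverse x) * qchar x = 1"
    by (simp flip: qchar_mult)
  then show ?thesis
    using qchar_cases[OF False] by auto
qed simp

lemma qchar_prod: "qchar (\<Prod>i\<in>I. f i :: 'a) = (\<Prod>i\<in>I. qchar (f i))"
  by (induction I rule: infinite_finite_induct) (simp_all add: qchar_mult)

lemma sum_qchar_affine:
  assumes "a \<noteq> (0::'a)"
  shows "(\<Sum>x\<in>UNIV. qchar (a * x + b)) = 0"
proof -
  have "(\<Sum>x\<in>UNIV. qchar (a * x + b)) = (\<Sum>x\<in>UNIV. qchar (x::'a))"
    by (rule sum.reindex_bij_witness[of _ "\<lambda>x. (x - b) / a" "\<lambda>x. a * x + b"]) (use assms in auto)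
  then show ?thesis by (simp add: sum_qchar)
qed

lemma sum_over_squares:
  fixes f :: "'a \<Rightarrow> int"
  shows "(\<Sum>t\<in>UNIV. f (t\<^sup>2)) = (\<Sum>y\<in>UNIV. (1 + qchar y) * f y)"
proof -
  have "(\<Sum>t\<in>UNIV. f (t\<^sup>2)) = (\<Sum>y\<in>range power2. \<Sum>t\<in>{t. t\<^sup>2 = y}. f (t\<^sup>2))"
    by (subst sum.image_gen[of UNIV _ "\<lambda>y::'a. y\<^sup>2"]) auto
  also have "\<dots> = (\<Sum>y\<in>UNIV. \<Sum>t\<in>{t. t\<^sup>2 = y}. f (t\<^sup>2))"
    by (rule sum.mono_neutral_left) (auto intro!: sum.neutral)
  also have "\<dots> = (\<Sum>y\<in>UNIV. \<Sum>t\<in>{t. t\<^sup>2 = y}. f y)"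
    by (intro sum.cong) auto
  finally show ?thesis by (simp add: card_square_roots)
qed

text \<open>Grouping by \<open>y = t\<^sup>2\<close> weights each \<open>y\<close> by \<open>1 + qchar y\<close>. This leaves a linear sum, which vanishes,
  and the Jacobi-type sum of \<open>qchar (y (c - e y))\<close>. Away from \<open>y = 0\<close> the latter becomes linear
  under \<open>y \<mapsto> 1 / y\<close>, and only the term missing there contributes.\<close>

lemma sum_qchar_quadratic:
  assumes e: "e \<noteq> (0::'a)"
  shows "(\<Sum>t\<in>UNIV. qchar (c - e * t\<^sup>2)) = qchar (- e) * (if c = 0 then int CARD('a) - 1 else - 1)"
proof -
  have "(\<Sum>t\<in>UNIV. qchar (c - e * t\<^sup>2)) = (\<Sum>y\<in>UNIV. (1 + qchar y) * qchar (c - e * y))"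
    by (rule sum_over_squares)
  also have "\<dots> = (\<Sum>y\<in>UNIV. qchar (c - e * y)) + (\<Sum>y\<in>UNIV. qchar (y * (c - e * y)))"
    by (simp only: qchar_mult distrib_right sum.distrib mult_1)
  also have "(\<Sum>y\<in>UNIV. qchar (c - e * y)) = 0"
    using sum_qchar_affine[of "- e" c] e by simp
  also have "(\<Sum>y\<in>UNIV. qchar (y * (c - e * y))) = (\<Sum>y\<in>UNIV - {0}. qchar (y * (c - e * y)))"
    by (rule sum.mono_neutral_right) auto
  also have "\<dots> = (\<Sum>z\<in>UNIV - {0}. qchar (c * z + (- e)))"
    \<comment> \<open>substitute \<open>y = 1 / z\<close> and drop the square \<open>y\<^sup>2\<close>\<close>
  proof (rule sum.reindex_bij_witness[of _ inverse inverse])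
    fix y :: 'a assume y: "y \<in> UNIV - {0}"
    then have "y * (c - e * y) = y\<^sup>2 * (c * inverse y + (- e))"
      by (simp add: field_simps power2_eq_square)
    then show "qchar (c * inverse y + - e) = qchar (y * (c - e * y))"
      using y by (simp add: qchar_mult)
  qed auto
  also have "\<dots> = (\<Sum>z\<in>UNIV. qchar (c * z + (- e))) - qchar (- e)"
    by (simp add: sum_diff1)
  also have "\<dots> = qchar (- e) * (if c = 0 then int CARD('a) - 1 else - 1)"
    using sum_qchar_affine[of c "- e"] by (auto simp: algebra_simps)
  finally show ?thesis by simp
qed

end

section \<open>Representation numbers of diagonal quadratic forms\<close>

text \<open>The number of representations of \<open>c\<close> by the diagonal quadratic form with coefficients \<open>e\<close>.\<close>

definition repnum :: "'i set \<Rightarrow> ('i \<Rightarrow> 'a::{field,finite}) \<Rightarrow> 'a \<Rightarrow> nat" where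
  "repnum R e c = card {u \<in> R \<rightarrow>\<^sub>E UNIV. (\<Sum>l\<in>R. e l * (u l)\<^sup>2) = c}"

lemma finite_PiE_UNIV: "finite R \<Longrightarrow> finite (R \<rightarrow>\<^sub>E (UNIV :: 'a::finite set))"
  by (intro finite_PiE) auto

lemma repnum_empty: "repnum {} e c = (if c = 0 then 1 else 0)"
  by (simp add: repnum_def)

lemma repnum_insert:
  fixes e :: "'i \<Rightarrow> 'a::{field,finite}"
  assumes R: "finite R" "l \<notin> R"
  shows "repnum (insert l R) e c = (\<Sum>t\<in>UNIV. repnum R e (c - e l * t\<^sup>2))"
proof -
  let ?S = "\<lambda>t. {u \<in> R \<rightarrow>\<^sub>E UNIV. (\<Sum>i\<in>R. e i * (u i)\<^sup>2) = c - e l * t\<^sup>2}"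
  have sum_upd: "(\<Sum>i\<in>R. e i * ((g(l := y)) i)\<^sup>2) = (\<Sum>i\<in>R. e i * (g i)\<^sup>2)" for g :: "'i \<Rightarrow> 'a" and y
    by (rule sum.cong) (use R in auto)
  have "{u \<in> insert l R \<rightarrow>\<^sub>E UNIV. (\<Sum>i\<in>insert l R. e i * (u i)\<^sup>2) = c}
      = (\<lambda>(y, g). g(l := y)) ` Sigma UNIV ?S"
    (is "?L = ?R")
  proof (intro equalityI subsetI)
    fix u assume "u \<in> ?L"
    then obtain y g where u: "u = g(l := y)" "g \<in> R \<rightarrow>\<^sub>E UNIV"
      and "(\<Sum>i\<in>insert l R. e i * (u i)\<^sup>2) = c"
      unfolding PiE_insert_eq by auto
    then have "e l * y\<^sup>2 + (\<Sum>i\<in>R. e i * (g i)\<^sup>2) = c"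
      using R sum_upd[of g y] by simp
    then have "(y, g) \<in> Sigma UNIV ?S"
      using u(2) by (simp add: eq_diff_eq add.commute)
    then show "u \<in> ?R"
      unfolding u(1) by (intro image_eqI[of _ _ "(y, g)"]) simp_all
  next
    fix u assume "u \<in> ?R"
    then obtain y g where u: "u = g(l := y)" and g: "g \<in> R \<rightarrow>\<^sub>E UNIV"
      "(\<Sum>i\<in>R. e i * (g i)\<^sup>2) = c - e l * y\<^sup>2"
      by auto
    have "u \<in> insert l R \<rightarrow>\<^sub>E UNIV"
      using g(1) by (auto simp: u PiE_iff extensional_def)
    moreover have "(\<Sum>i\<in>insert l R. e i * (u i)\<^sup>2) = c"
      using R g(2) sum_upd[of g y] by (simp add: u)
    ultimately show "u \<in> ?L" by simp
  qed
  moreover have "inj_on (\<lambda>(y, g). g(l := y)) (Sigma UNIV ?S)"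
    by (rule inj_on_subset[OF inj_combinator[OF R(2), of "\<lambda>_. UNIV"]]) auto
  ultimately show ?thesis
    unfolding repnum_def
    by (simp add: card_image card_SigmaI finite_PiE_UNIV[OF R(1)])
qed

context odd_finite_field
begin

text \<open>Induction on the number of variables: fixing the new variable \<open>t\<close> leaves the old form with target
  \<open>c - e\<^sub>l t\<^sup>2\<close>. From even to odd the error term is a multiple of the number of \<open>t\<close> with
  \<open>e\<^sub>l t\<^sup>2 = c\<close>, from odd to even it is \<open>sum_qchar_quadratic\<close>. The first formula is multiplied by \<open>q\<close>
  so that it stays integral and includes the empty form.\<close>

lemma repnum_formula:
  fixes e :: "'i \<Rightarrow> 'a"
  assumes "finite R" "\<forall>l\<in>R. e l \<noteq> 0"
  shows "even (card R) \<Longrightarrow> int CARD('a) * int (repnum R e c) =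
           int CARD('a) ^ card R
           + int CARD('a) ^ (card R div 2) * qchar ((- 1) ^ (card R div 2) * (\<Prod>l\<in>R. e l))
             * (if c = 0 then int CARD('a) - 1 else - 1)"
    and "odd (card R) \<Longrightarrow> int (repnum R e c) =
           int CARD('a) ^ (card R - 1)
           + int CARD('a) ^ (card R div 2) * qchar ((- 1) ^ (card R div 2) * c * (\<Prod>l\<in>R. e l))"
proof -
  let ?q = "int CARD('a)"
  let ?thesis1 = "\<lambda>R c. ?q * int (repnum R e c) = ?q ^ card R
           + ?q ^ (card R div 2) * qchar ((- 1) ^ (card R div 2) * (\<Prod>l\<in>R. e l))
             * (if c = 0 then ?q - 1 else - 1)"
  let ?thesis2 = "\<lambda>R c. int (repnum R e c) = ?q ^ (card R - 1)
           + ?q ^ (card R div 2) * qchar ((- 1) ^ (card R div 2) * c * (\<Prod>l\<in>R. e l))"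
  have "(even (card R) \<longrightarrow> ?thesis1 R c) \<and> (odd (card R) \<longrightarrow> ?thesis2 R c)"
    using assms
  proof (induction R arbitrary: c rule: finite_induct)
    case empty
    then show ?case by (simp add: repnum_empty)
  next
    case (insert l R)
    have el: "e l \<noteq> 0" using insert.prems by simp
    have rep: "int (repnum (insert l R) e c) = (\<Sum>t\<in>UNIV. int (repnum R e (c - e l * t\<^sup>2)))"
      using insert.hyps by (simp add: repnum_insert)
    show ?case
    proof (cases "even (card R)")
      case True
      then obtain m where m: "card R = 2 * m" by (rule evenE)
      let ?X = "qchar ((- 1) ^ m * (\<Prod>l\<in>R. e l))"
      have "?q * int (repnum (insert l R) e c) = (\<Sum>t\<in>UNIV. ?q * int (repnum R e (c - e l * t\<^sup>2)))"
        unfolding rep by (simp add: sum_distrib_left)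
      also have "\<dots> = (\<Sum>t\<in>(UNIV::'a set). ?q ^ (2 * m)
             + ?q ^ m * ?X * (if c - e l * t\<^sup>2 = 0 then ?q - 1 else - 1))"
        by (rule sum.cong[OF refl]) (use insert m in simp)
      also have "\<dots> = ?q * ?q ^ (2 * m)
             + ?q ^ m * ?X * (\<Sum>t\<in>(UNIV::'a set). if c - e l * t\<^sup>2 = 0 then ?q - 1 else - 1)"
        by (simp add: sum.distrib sum_distrib_left)
      also have "(\<Sum>t\<in>(UNIV::'a set). if c - e l * t\<^sup>2 = 0 then ?q - 1 else - 1)
          = (\<Sum>t\<in>(UNIV::'a set). (if t\<^sup>2 = c / e l then ?q else 0) - 1)"
        by (rule sum.cong[OF refl]) (use el in \<open>auto simp: field_simps\<close>)
      also have "\<dots> = ?q * (1 + qchar (c / e l)) - ?q"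
        using card_square_roots[of "c / e l"]
        by (simp add: sum_subtractf flip: sum.inter_filter)
      also have "qchar (c / e l) = qchar (c * e l)"
        by (simp add: divide_inverse qchar_mult qchar_inverse)
      finally have "?q * int (repnum (insert l R) e c)
          = ?q * (?q ^ (2 * m) + ?q ^ m * (?X * qchar (c * e l)))"
        by (simp add: algebra_simps)
      then have "int (repnum (insert l R) e c) = ?q ^ (2 * m) + ?q ^ m * (?X * qchar (c * e l))"
        by simp
      then show ?thesis
        using insert.hyps m by (simp add: qchar_mult mult_ac)
    next
      case False
      then obtain m where m: "card R = 2 * m + 1" by (rule oddE)
      let ?X = "qchar ((- 1) ^ m * (\<Prod>l\<in>R. e l))"
      have "int (repnum (insert l R) e c) = (\<Sum>t\<in>(UNIV::'a set). ?q ^ (2 * m)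
             + ?q ^ m * ?X * qchar (c - e l * t\<^sup>2))"
        unfolding rep
        by (rule sum.cong[OF refl]) (use insert m in \<open>simp add: qchar_mult mult_ac\<close>)
      also have "\<dots> = ?q * ?q ^ (2 * m) + ?q ^ m * ?X * (\<Sum>t\<in>UNIV. qchar (c - e l * t\<^sup>2))"
        by (simp add: sum.distrib sum_distrib_left)
      finally have "?q * int (repnum (insert l R) e c) = ?q ^ (2 * m + 2)
          + ?q ^ Suc m * (?X * qchar (- e l)) * (if c = 0 then ?q - 1 else - 1)"
        unfolding sum_qchar_quadratic[OF el] by (simp add: algebra_simps)
      moreover have "?X * qchar (- e l) = qchar ((- 1) ^ Suc m * (\<Prod>l\<in>insert l R. e l))"
        using insert.hyps by (simp add: mult_ac flip: qchar_mult)
      ultimately show ?thesis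
        using insert.hyps m by simp
    qed
  qed
  then show "even (card R) \<Longrightarrow> ?thesis1 R c" and "odd (card R) \<Longrightarrow> ?thesis2 R c"
    by blast+
qed

end

section \<open>Diagonalization by congruence and bordered matrices\<close>

lemma invertible_matE:
  assumes P: "P \<in> carrier_mat n n" and inv: "invertible_mat (P :: 'a::field mat)"
  obtains Q where "\<And>i k. i < n \<Longrightarrow> k < n \<Longrightarrow> (\<Sum>l<n. P $$ (i, l) * Q $$ (l, k)) = (if i = k then 1 else 0)"
    and "\<And>i k. i < n \<Longrightarrow> k < n \<Longrightarrow> (\<Sum>l<n. Q $$ (i, l) * P $$ (l, k)) = (if i = k then 1 else 0)"
proof -
  from inv obtain Q where Q: "inverts_mat P Q" "inverts_mat Q P"
    by (auto simp: invertible_mat_def)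
  have "Q \<in> carrier_mat n n"
  proof
    show "dim_col Q = n"
      using Q(1) P unfolding inverts_mat_def by (metis carrier_matD(1) index_mult_mat(3) index_one_mat(3))
    show "dim_row Q = n"
      using Q(2) P unfolding inverts_mat_def by (metis carrier_matD(2) index_mult_mat(3) index_one_mat(3))
  qed
  have entry: "(\<Sum>l<n. A $$ (i, l) * B $$ (l, k)) = (A * B) $$ (i, k)"
    if "A \<in> carrier_mat n n" "B \<in> carrier_mat n n" "i < n" "k < n" for A B :: "'a mat" and i k
    using that by (auto simp: scalar_prod_def atLeast0LessThan intro!: sum.cong)
  have "P * Q = 1\<^sub>m n" "Q * P = 1\<^sub>m n"
    using Q P \<open>Q \<in> carrier_mat n n\<close> by (auto simp: inverts_mat_def)
  then show thesis
    using P \<open>Q \<in> carrier_mat n n\<close> by (intro that[of Q]) (simp_all add: entry)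
qed

text \<open>Invertibility of \<open>P\<close> is verified below in this form: the linear forms given by the columns
  of \<open>P\<close> have no common zero except \<open>0\<close>.\<close>

lemma det_neq_0I:
  assumes P: "(P :: 'a::field mat) \<in> carrier_mat n n"
    and inj: "\<And>x i. (\<And>l. l < n \<Longrightarrow> (\<Sum>i<n. P $$ (i, l) * x i) = 0) \<Longrightarrow> i < n \<Longrightarrow> x i = 0"
  shows "det P \<noteq> 0"
proof -
  have "det P\<^sup>T \<noteq> 0"
  proof
    assume "det P\<^sup>T = 0"
    then obtain v where v: "v \<in> carrier_vec n" "v \<noteq> 0\<^sub>v n" "P\<^sup>T *\<^sub>v v = 0\<^sub>v n"
      using det_0_iff_vec_prod_zero_field[of "P\<^sup>T" n] P by auto
    have "(\<Sum>i<n. P $$ (i, l) * v $ i) = (P\<^sup>T *\<^sub>v v) $ l" if "l < n" for l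
      using that P v(1) by (auto simp: scalar_prod_def atLeast0LessThan intro!: sum.cong)
    then have "v $ i = 0" if "i < n" for i
      using inj[of "\<lambda>i. v $ i" i] v(3) that by simp
    then have "v = 0\<^sub>v n"
      using v(1) by auto
    with v(2) show False ..
  qed
  then show "det P \<noteq> 0"
    using det_transpose[OF P] by simp
qed

lemma invertible_matI:
  assumes P: "(P :: 'a::field mat) \<in> carrier_mat n n"
    and inj: "\<And>x i. (\<And>l. l < n \<Longrightarrow> (\<Sum>i<n. P $$ (i, l) * x i) = 0) \<Longrightarrow> i < n \<Longrightarrow> x i = 0"
  shows "invertible_mat P"
proof -
  have "det P \<noteq> 0"
    by (rule det_neq_0I[OF P]) (rule inj)
  then have "P \<in> Units (ring_mat TYPE('a) n ())"
    by (rule det_non_zero_imp_unit[OF P])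
  then obtain Q where "Q \<in> carrier_mat n n" "P * Q = 1\<^sub>m n" "Q * P = 1\<^sub>m n"
    by (auto simp: Units_def ring_mat_def)
  then show ?thesis
    using P by (auto simp: invertible_mat_def inverts_mat_def intro!: exI[of _ Q])
qed

lemma invertible_mat_inj:
  assumes P: "P \<in> carrier_mat n n" "invertible_mat (P :: 'a::field mat)"
    and x: "\<And>l. l < n \<Longrightarrow> (\<Sum>i<n. P $$ (i, l) * x i) = 0" and k: "k < n"
  shows "x k = 0"
proof -
  obtain Q where Q: "\<And>i k. i < n \<Longrightarrow> k < n \<Longrightarrow> (\<Sum>l<n. P $$ (i, l) * Q $$ (l, k)) = (if i = k then 1 else 0)"
    by (rule invertible_matE[OF P]) blast
  have "x k = (\<Sum>i<n. x i * (if i = k then 1 else 0))"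
    using k by (simp add: if_distrib[of "(*) _"] cong: if_cong)
  also have "\<dots> = (\<Sum>i<n. \<Sum>l<n. (P $$ (i, l) * x i) * Q $$ (l, k))"
    by (rule sum.cong[OF refl]) (use Q k in \<open>simp add: mult_ac flip: sum_distrib_left\<close>)
  also have "\<dots> = (\<Sum>l<n. (\<Sum>i<n. P $$ (i, l) * x i) * Q $$ (l, k))"
    by (subst sum.swap) (simp add: sum_distrib_right)
  also have "\<dots> = 0"
    by (rule sum.neutral) (use x in simp)
  finally show ?thesis .
qed

text \<open>Vectors that are summed over are extensional functions on \<open>{..<n}\<close>, a finite set over a finite
  field, rather than elements of the type of vectors of arbitrary dimension.\<close>

definition apply_mat :: "nat \<Rightarrow> (nat \<Rightarrow> nat \<Rightarrow> 'a::semiring_0) \<Rightarrow> (nat \<Rightarrow> 'a) \<Rightarrow> nat \<Rightarrow> 'a" where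
  "apply_mat n M u = restrict (\<lambda>i. \<Sum>l<n. M i l * u l) {..<n}"

lemma apply_mat_inverse:
  fixes A B :: "nat \<Rightarrow> nat \<Rightarrow> 'a::field"
  assumes AB: "\<And>i k. i < n \<Longrightarrow> k < n \<Longrightarrow> (\<Sum>l<n. A i l * B l k) = (if i = k then 1 else 0)"
    and u: "u \<in> {..<n} \<rightarrow>\<^sub>E UNIV"
  shows "apply_mat n A (apply_mat n B u) = u"
proof (rule ext)
  fix i
  show "apply_mat n A (apply_mat n B u) i = u i"
  proof (cases "i < n")
    case True
    have "apply_mat n A (apply_mat n B u) i = (\<Sum>l<n. \<Sum>k<n. A i l * B l k * u k)"
      using True by (simp add: apply_mat_def sum_distrib_left mult.assoc)
    also have "\<dots> = (\<Sum>k<n. (\<Sum>l<n. A i l * B l k) * u k)"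
      by (subst sum.swap) (simp add: sum_distrib_right)
    also have "\<dots> = (\<Sum>k<n. (if i = k then u k else 0))"
      by (rule sum.cong) (use AB True in auto)
    finally show ?thesis
      using True by simp
  next
    case False
    then show ?thesis
      using PiE_arb[OF u, of i] by (simp add: apply_mat_def)
  qed
qed

lemma apply_mat_PiE: "apply_mat n A u \<in> {..<n} \<rightarrow>\<^sub>E UNIV"
  by (simp add: apply_mat_def)

lemma bij_betw_apply_mat:
  fixes M N :: "nat \<Rightarrow> nat \<Rightarrow> 'a::field"
  assumes MN: "\<And>i k. i < n \<Longrightarrow> k < n \<Longrightarrow> (\<Sum>l<n. M i l * N l k) = (if i = k then 1 else 0)"
    and NM: "\<And>i k. i < n \<Longrightarrow> k < n \<Longrightarrow> (\<Sum>l<n. N i l * M l k) = (if i = k then 1 else 0)"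
  shows "bij_betw (apply_mat n M) ({..<n} \<rightarrow>\<^sub>E UNIV) ({..<n} \<rightarrow>\<^sub>E UNIV)"
proof (rule bij_betw_byWitness[where f' = "apply_mat n N"])
  show "\<forall>u\<in>{..<n} \<rightarrow>\<^sub>E UNIV. apply_mat n N (apply_mat n M u) = u"
    using apply_mat_inverse[of n N M, OF NM] by blast
  show "\<forall>u\<in>{..<n} \<rightarrow>\<^sub>E UNIV. apply_mat n M (apply_mat n N u) = u"
    using apply_mat_inverse[of n M N, OF MN] by blast
qed (use apply_mat_PiE in blast)+

text \<open>\<open>A = P \<cdot> diag d \<cdot> P\<^sup>T\<close>, entry by entry. As \<open>d\<close> is a function, a border changes it by function
  update, and its zeros may stand anywhere. Equivalently, the quadratic form of \<open>A\<close> is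
  \<open>\<Sum>l<n. d\<^sub>l X\<^sub>l\<^sup>2\<close>, where \<open>X\<^sub>l\<close> is the linear form given by column \<open>l\<close> of \<open>P\<close>.\<close>

definition diagonalizes :: "nat \<Rightarrow> 'a::field mat \<Rightarrow> 'a mat \<Rightarrow> (nat \<Rightarrow> 'a) \<Rightarrow> bool" where
  "diagonalizes n A P d \<longleftrightarrow> P \<in> carrier_mat n n \<and> invertible_mat P \<and>
     (\<forall>i<n. \<forall>k<n. A $$ (i, k) = (\<Sum>l<n. P $$ (i, l) * d l * P $$ (k, l)))"

definition supp :: "nat \<Rightarrow> (nat \<Rightarrow> 'a::zero) \<Rightarrow> nat set" where
  "supp n d = {l. l < n \<and> d l \<noteq> 0}"

lemma finite_supp [simp]: "finite (supp n d)"
  by (simp add: supp_def)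

lemma supp_subset: "supp n d \<subseteq> {..<n}"
  by (auto simp: supp_def)

definition border :: "nat \<Rightarrow> 'a mat \<Rightarrow> (nat \<Rightarrow> 'a) \<Rightarrow> 'a \<Rightarrow> 'a mat" where
  "border n A v a = mat (Suc n) (Suc n) (\<lambda>(i, k).
     if i < n then if k < n then A $$ (i, k) else v i else if k < n then v k else a)"

text \<open>The condition on \<open>u\<close> says that \<open>v = P u\<close> lies in the column space of \<open>A\<close>. With a new variable
  \<open>y\<close>, completing the squares turns \<open>\<Sum>d\<^sub>l X\<^sub>l\<^sup>2 + 2 y \<Sum>u\<^sub>l X\<^sub>l + a y\<^sup>2\<close> into
  \<open>\<Sum>d\<^sub>l (X\<^sub>l + (u\<^sub>l / d\<^sub>l) y)\<^sup>2 + (a - \<Sum>u\<^sub>l\<^sup>2 / d\<^sub>l) y\<^sup>2\<close>. Where \<open>d\<^sub>l = 0\<close> also \<open>u\<^sub>l = 0\<close>, and the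
  convention \<open>x / 0 = 0\<close> gives the right terms.\<close>

lemma diagonalizes_border_in_range:
  assumes diag: "diagonalizes n A P d"
    and v: "\<forall>i<n. v i = (\<Sum>l<n. P $$ (i, l) * u l)"
    and u: "\<forall>l<n. d l = 0 \<longrightarrow> u l = 0"
  shows "\<exists>P'. diagonalizes (Suc n) (border n A v a) P' (d(n := a - (\<Sum>l<n. (u l)\<^sup>2 / d l)))"
proof -
  define P' where "P' = mat (Suc n) (Suc n) (\<lambda>(i, l).
     if i < n then if l < n then P $$ (i, l) else 0 else if l < n then u l / d l else 1)"
  let ?d = "d(n := a - (\<Sum>l<n. (u l)\<^sup>2 / d l))"
  have P: "P \<in> carrier_mat n n" "invertible_mat P"
    and A: "\<And>i k. i < n \<Longrightarrow> k < n \<Longrightarrow> A $$ (i, k) = (\<Sum>l<n. P $$ (i, l) * d l * P $$ (k, l))"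
    using diag by (auto simp: diagonalizes_def)
  have ud: "d l * (u l / d l) = u l" if "l < n" for l
    using u that by auto
  have "invertible_mat P'"
  proof (rule invertible_matI)
    show "P' \<in> carrier_mat (Suc n) (Suc n)" by (simp add: P'_def)
    fix x :: "nat \<Rightarrow> 'a" and i
    assume x: "\<And>l. l < Suc n \<Longrightarrow> (\<Sum>i<Suc n. P' $$ (i, l) * x i) = 0" and i: "i < Suc n"
    have "x n = 0"
      using x[of n] by (simp add: P'_def)
    moreover have "(\<Sum>i<n. P $$ (i, l) * x i) = 0" if "l < n" for l
      using x[of l] that \<open>x n = 0\<close> by (simp add: P'_def)
    then have "x i = 0" if "i < n" for i
      using invertible_mat_inj[OF P _ that] by blast
    ultimately show "x i = 0"
      using i by (cases "i = n") auto
  qed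
  moreover have "border n A v a $$ (i, k) = (\<Sum>l<Suc n. P' $$ (i, l) * ?d l * P' $$ (k, l))"
    if "i < Suc n" "k < Suc n" for i k
  proof -
    have "(\<Sum>l<n. u l / d l * d l * (u l / d l)) = (\<Sum>l<n. (u l)\<^sup>2 / d l)"
      by (rule sum.cong) (auto simp: power2_eq_square)
    moreover have "(\<Sum>l<n. P $$ (i, l) * d l * (u l / d l)) = v i" if "i < n" for i
      using v u that by (auto intro!: sum.cong)
    moreover have "(\<Sum>l<n. u l / d l * d l * P $$ (i, l)) = v i" if "i < n" for i
      using v u that by (auto intro!: sum.cong)
    ultimately show ?thesis
      using that by (auto simp: border_def P'_def A less_Suc_eq)
  qed
  ultimately show ?thesis
    by (intro exI[of _ P']) (auto simp: diagonalizes_def P'_def)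
qed

text \<open>Put \<open>z = \<Sum>u\<^sub>l X\<^sub>l + a y / 2\<close>. The terms of the border that involve the new variable \<open>y\<close> are
  \<open>2 y z = ((y + z)\<^sup>2 - (y - z)\<^sup>2) / 2\<close>, a hyperbolic plane. The form \<open>X\<^sub>j\<close> does not occur in the form
  of \<open>A\<close>, and as \<open>u\<^sub>j \<noteq> 0\<close> it can be exchanged for \<open>z\<close>; so \<open>y + z\<close> and \<open>y - z\<close> may take the places
  \<open>j\<close> and \<open>n\<close>.\<close>

lemma diagonalizes_border_off_range:
  assumes diag: "diagonalizes n A P d"
    and v: "\<forall>i<n. v i = (\<Sum>l<n. P $$ (i, l) * u l)"
    and j: "j < n" "d j = 0" "u j \<noteq> 0"
    and two: "(2 :: 'a::field) \<noteq> 0"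
  shows "\<exists>P'. diagonalizes (Suc n) (border n A v (a :: 'a)) P' (d(j := 1 / 2, n := - 1 / 2))"
proof -
  \<comment> \<open>columns \<open>j\<close> and \<open>n\<close> hold the coefficients of \<open>y + z\<close> and \<open>y - z\<close>\<close>
  define P' where "P' = mat (Suc n) (Suc n) (\<lambda>(i, l).
     if l = j then if i < n then v i else 1 + a / 2
     else if l = n then if i < n then - v i else 1 - a / 2
     else if i < n then P $$ (i, l) else 0)"
  let ?d = "d(j := 1 / 2, n := - 1 / 2)"
  have P: "P \<in> carrier_mat n n" "invertible_mat P"
    and A: "\<And>i k. i < n \<Longrightarrow> k < n \<Longrightarrow> A $$ (i, k) = (\<Sum>l<n. P $$ (i, l) * d l * P $$ (k, l))"
    using diag by (auto simp: diagonalizes_def)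
  \<comment> \<open>the denominators that clearing fractions in \<open>1 \<plusminus> a / 2\<close> produces\<close>
  have four: "(4 :: 'a) \<noteq> 0"
    using two mult_eq_0_iff[of "2 :: 'a" 2] by simp
  have eight: "(8 :: 'a) \<noteq> 0"
    using two four mult_eq_0_iff[of "4 :: 'a" 2] by simp
  have "invertible_mat P'"
  proof (rule invertible_matI)
    show "P' \<in> carrier_mat (Suc n) (Suc n)" by (simp add: P'_def)
    fix x :: "nat \<Rightarrow> 'a" and i
    assume x: "\<And>l. l < Suc n \<Longrightarrow> (\<Sum>i<Suc n. P' $$ (i, l) * x i) = 0" and i: "i < Suc n"
    have "(\<Sum>i<n. v i * x i) + (1 + a / 2) * x n = 0"
      using x[of j] j by (simp add: P'_def)
    moreover have "- (\<Sum>i<n. v i * x i) + (1 - a / 2) * x n = 0"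
      using x[of n] j by (simp add: P'_def sum_negf)
    ultimately have "2 * x n = 0"
      by (simp add: algebra_simps)
    then have xn: "x n = 0" using two by simp
    have "(\<Sum>i<n. v i * x i) = 0"
      using x[of j] j xn by (simp add: P'_def)
    also have "(\<Sum>i<n. v i * x i) = (\<Sum>i<n. \<Sum>l<n. u l * (P $$ (i, l) * x i))"
      by (rule sum.cong) (simp_all add: v sum_distrib_left sum_distrib_right mult_ac)
    also have "\<dots> = (\<Sum>l<n. u l * (\<Sum>i<n. P $$ (i, l) * x i))"
      by (subst sum.swap) (simp add: sum_distrib_left)
    also have others: "(\<Sum>i<n. P $$ (i, l) * x i) = 0" if "l < n" "l \<noteq> j" for l
      using x[of l] that xn by (simp add: P'_def)
    have "(\<Sum>l<n. u l * (\<Sum>i<n. P $$ (i, l) * x i)) = u j * (\<Sum>i<n. P $$ (i, j) * x i)"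
      using j by (subst sum.remove[of _ j]) (auto intro!: sum.neutral simp: others)
    finally have "(\<Sum>i<n. P $$ (i, j) * x i) = 0"
      using j by simp
    with others have "(\<Sum>i<n. P $$ (i, l) * x i) = 0" if "l < n" for l
      using that by (cases "l = j") auto
    then have "x i = 0" if "i < n" for i
      using invertible_mat_inj[OF P _ that] by blast
    then show "x i = 0"
      using i xn by (cases "i = n") auto
  qed
  moreover have "border n A v a $$ (i, k) = (\<Sum>l<Suc n. P' $$ (i, l) * ?d l * P' $$ (k, l))"
    if ik: "i < Suc n" "k < Suc n" for i k
  proof -
    have "(\<Sum>l<Suc n. P' $$ (i, l) * ?d l * P' $$ (k, l)) =
        (\<Sum>l\<in>{..<n} - {j}. P' $$ (i, l) * ?d l * P' $$ (k, l))
        + (P' $$ (i, j) * P' $$ (k, j) - P' $$ (i, n) * P' $$ (k, n)) / 2"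
      using j by (simp add: sum.remove[of _ j] field_simps)
    also have "(P' $$ (i, j) * P' $$ (k, j) - P' $$ (i, n) * P' $$ (k, n)) / 2
        = (if i < n then if k < n then 0 else v i else if k < n then v k else a)"
      using ik j two four eight by (auto simp: P'_def less_Suc_eq field_simps)
    also have "(\<Sum>l\<in>{..<n} - {j}. P' $$ (i, l) * ?d l * P' $$ (k, l))
        = (if i < n \<and> k < n then A $$ (i, k) else 0)"
    proof (cases "i < n \<and> k < n")
      case True
      then have "A $$ (i, k) = (\<Sum>l\<in>{..<n} - {j}. P $$ (i, l) * d l * P $$ (k, l))"
        using j by (simp add: A sum.remove[of _ j])
      also have "\<dots> = (\<Sum>l\<in>{..<n} - {j}. P' $$ (i, l) * ?d l * P' $$ (k, l))"
        by (rule sum.cong) (use True in \<open>auto simp: P'_def\<close>)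
      finally show ?thesis using True by simp
    qed (use ik in \<open>auto intro!: sum.neutral simp: P'_def\<close>)
    finally show ?thesis
      using ik by (auto simp: border_def)
  qed
  ultimately show ?thesis
    by (intro exI[of _ P']) (auto simp: diagonalizes_def P'_def)
qed

lemma diagonalizes_basis_coordinates:
  assumes "diagonalizes n A P d"
  shows "\<exists>u. \<forall>i<n. v i = (\<Sum>l<n. P $$ (i, l) * u l)"
proof -
  have P: "P \<in> carrier_mat n n" "invertible_mat P"
    using assms by (auto simp: diagonalizes_def)
  obtain Q where Q: "\<And>i k. i < n \<Longrightarrow> k < n \<Longrightarrow> (\<Sum>l<n. P $$ (i, l) * Q $$ (l, k)) = (if i = k then 1 else 0)"
    by (rule invertible_matE[OF P]) blast
  have "(\<Sum>l<n. P $$ (i, l) * (\<Sum>k<n. Q $$ (l, k) * v k)) = v i" if "i < n" for i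
  proof -
    have "(\<Sum>l<n. P $$ (i, l) * (\<Sum>k<n. Q $$ (l, k) * v k))
        = (\<Sum>k<n. (\<Sum>l<n. P $$ (i, l) * Q $$ (l, k)) * v k)"
      by (simp add: sum_distrib_left sum_distrib_right mult.assoc) (rule sum.swap)
    also have "\<dots> = (\<Sum>k<n. if i = k then v k else 0)"
      by (rule sum.cong) (use Q that in auto)
    finally show ?thesis using that by simp
  qed
  then show ?thesis
    by (intro exI[of _ "\<lambda>l. \<Sum>k<n. Q $$ (l, k) * v k"]) simp
qed

lemma border_decomposition:
  assumes "sym_mat (Suc n) A"
  defines "A0 \<equiv> mat n n (\<lambda>(i, k). A $$ (i, k))"
  shows "sym_mat n A0" and "A = border n A0 (\<lambda>i. A $$ (i, n)) (A $$ (n, n))"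
proof -
  have A: "A \<in> carrier_mat (Suc n) (Suc n)" and tr: "A\<^sup>T = A"
    using assms by (auto simp: sym_mat_def)
  have sym: "A $$ (k, i) = A $$ (i, k)" if "i < Suc n" "k < Suc n" for i k
    using that A index_transpose_mat(1)[of i A k] by (simp add: tr)
  show "sym_mat n A0"
    by (auto simp: sym_mat_def A0_def sym)
  show "A = border n A0 (\<lambda>i. A $$ (i, n)) (A $$ (n, n))"
    using A by (intro eq_matI) (auto simp: border_def A0_def less_Suc_eq sym)
qed

text \<open>Every symmetric matrix is a border of a smaller one, so the two border lemmas diagonalize it by
  induction on its size.\<close>

lemma exists_diagonalizes:
  fixes A :: "'a::field mat"
  assumes two: "(2 :: 'a) \<noteq> 0" and "sym_mat n A"
  shows "\<exists>P d. diagonalizes n A P d"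
  using assms(2)
proof (induction n arbitrary: A)
  case 0
  have "invertible_mat (1\<^sub>m 0 :: 'a mat)"
    by (rule invertible_matI[of _ 0]) auto
  then show ?case
    by (auto simp: diagonalizes_def intro!: exI[of _ "1\<^sub>m 0 :: 'a mat"])
next
  case (Suc n)
  define A0 where "A0 = mat n n (\<lambda>(i, k). A $$ (i, k))"
  note dec = border_decomposition[OF Suc.prems, folded A0_def]
  obtain P d where diag: "diagonalizes n A0 P d"
    using Suc.IH[OF dec(1)] by blast
  obtain u where u: "\<forall>i<n. A $$ (i, n) = (\<Sum>l<n. P $$ (i, l) * u l)"
    using diagonalizes_basis_coordinates[OF diag, of "\<lambda>i. A $$ (i, n)"] by blast
  show ?case
  proof (cases "\<exists>j<n. d j = 0 \<and> u j \<noteq> 0")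
    case True
    then obtain j where j: "j < n" "d j = 0" "u j \<noteq> 0" by blast
    have "\<exists>P' d'. diagonalizes (Suc n) (border n A0 (\<lambda>i. A $$ (i, n)) a) P' d'" for a
      using diagonalizes_border_off_range[where v = "\<lambda>i. A $$ (i, n)" and u = u, OF diag _ j two] u
      by blast
    then show ?thesis
      by (subst dec(2)) simp
  next
    case False
    then have "\<exists>P' d'. diagonalizes (Suc n) (border n A0 (\<lambda>i. A $$ (i, n)) a) P' d'" for a
      using diagonalizes_border_in_range[where v = "\<lambda>i. A $$ (i, n)" and u = u, OF diag] u
      by blast
    then show ?thesis
      by (subst dec(2)) simp
  qed
qed

lemma rank_sum_rank_one_le:
  fixes p :: "nat \<Rightarrow> nat \<Rightarrow> 'a::field"
  assumes "finite L"
  shows "vec_space.rank n (mat n n (\<lambda>(i, k). \<Sum>l\<in>L. p i l * d l * p k l)) \<le> card L"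
  using assms
proof (induction L rule: finite_induct)
  case empty
  have "mat n n (\<lambda>(i, k). \<Sum>l\<in>{}. p i l * d l * p k l) = 0\<^sub>m n n"
    by (intro eq_matI) auto
  then show ?case
    by (simp only: vec_space.rank_0I)
next
  case (insert m L)
  let ?M = "mat n n (\<lambda>(i, k). p i m * d m * p k m)"
  let ?N = "mat n n (\<lambda>(i, k). \<Sum>l\<in>L. p i l * d l * p k l)"
  have "mat n n (\<lambda>(i, k). \<Sum>l\<in>insert m L. p i l * d l * p k l) = ?M + ?N"
    using insert.hyps by (intro eq_matI) auto
  moreover have "vec_space.rank n (?M + ?N) \<le> vec_space.rank n ?M + vec_space.rank n ?N"
    by (rule vec_space.rank_subadditive) auto
  moreover have "vec_space.rank n ?M \<le> 1"
    by (rule vec_space.rank_le_1_product_entries[where nc = n and f = "\<lambda>i. p i m * d m" and g = "\<lambda>k. p k m"]) auto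
  ultimately show ?case
    using insert by simp
qed

text \<open>\<open>A\<close> is a sum of \<open>card (supp n d)\<close> matrices of rank at most one, which bounds the rank from above.
  Replacing the zeros of \<open>d\<close> by ones adds at most \<open>n - card (supp n d)\<close> to the rank and gives an
  invertible matrix, which bounds it from below.\<close>

lemma diagonalizes_rank:
  fixes A :: "'a::field mat"
  assumes diag: "diagonalizes n A P d" and A: "A \<in> carrier_mat n n"
  shows "vec_space.rank n A = card (supp n d)"
proof -
  have P: "P \<in> carrier_mat n n" "invertible_mat P"
    and entry: "\<And>i k. i < n \<Longrightarrow> k < n \<Longrightarrow> A $$ (i, k) = (\<Sum>l<n. P $$ (i, l) * d l * P $$ (k, l))"
    using diag by (auto simp: diagonalizes_def)
  let ?B = "\<lambda>L d. mat n n (\<lambda>(i, k). \<Sum>l\<in>L. P $$ (i, l) * d l * P $$ (k, l))"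
  define Z where "Z = {..<n} - supp n d"
  have split: "(\<Sum>l<n. f l) = (\<Sum>l\<in>supp n d. f l) + (\<Sum>l\<in>Z. f l)" for f :: "nat \<Rightarrow> 'a"
    unfolding Z_def using supp_subset[of n d]
    by (subst sum.subset_diff[of "supp n d"]) (auto simp: add.commute)
  have A_eq: "A = ?B (supp n d) d"
  proof (rule eq_matI)
    fix i k assume "i < dim_row (?B (supp n d) d)" "k < dim_col (?B (supp n d) d)"
    then show "A $$ (i, k) = ?B (supp n d) d $$ (i, k)"
      using entry[of i k] split by (auto simp: Z_def supp_def intro!: sum.neutral)
  qed (use A in auto)
  have le: "vec_space.rank n A \<le> card (supp n d)"
    by (subst A_eq) (rule rank_sum_rank_one_le, simp)
  define d' where "d' = (\<lambda>l. if l \<in> supp n d then d l else 1)"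
  have sum_eq: "A + ?B Z (\<lambda>_. 1) = ?B {..<n} d'"
    by (subst A_eq, intro eq_matI) (auto simp: split d'_def Z_def intro!: sum.cong)
  obtain Q where QP: "\<And>i k. i < n \<Longrightarrow> k < n \<Longrightarrow> (\<Sum>l<n. Q $$ (i, l) * P $$ (l, k)) = (if i = k then 1 else 0)"
    by (rule invertible_matE[OF P]) blast
  have "det (?B {..<n} d') \<noteq> 0"
  proof (rule det_neq_0I)
    show "?B {..<n} d' \<in> carrier_mat n n" by simp
    fix x :: "nat \<Rightarrow> 'a" and i
    assume x: "\<And>k. k < n \<Longrightarrow> (\<Sum>i<n. ?B {..<n} d' $$ (i, k) * x i) = 0" and i: "i < n"
    define y where "y l = d' l * (\<Sum>i<n. P $$ (i, l) * x i)" for l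
    have Py: "(\<Sum>l<n. P $$ (k, l) * y l) = 0" if "k < n" for k
    proof -
      have "(\<Sum>i<n. ?B {..<n} d' $$ (i, k) * x i) = (\<Sum>i<n. \<Sum>l<n. P $$ (k, l) * (d' l * (P $$ (i, l) * x i)))"
        using that by (intro sum.cong) (simp_all add: sum_distrib_left sum_distrib_right mult_ac)
      also have "\<dots> = (\<Sum>l<n. P $$ (k, l) * y l)"
        by (subst sum.swap) (simp add: y_def sum_distrib_left)
      finally show ?thesis using x[OF that] by simp
    qed
    have "y m = 0" if "m < n" for m
    proof -
      have "y m = (\<Sum>l<n. if m = l then y l else 0)"
        using that by simp
      also have "\<dots> = (\<Sum>l<n. (\<Sum>k<n. Q $$ (m, k) * P $$ (k, l)) * y l)"
        by (rule sum.cong) (use QP that in auto)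
      also have "\<dots> = (\<Sum>k<n. Q $$ (m, k) * (\<Sum>l<n. P $$ (k, l) * y l))"
        by (simp add: sum_distrib_left sum_distrib_right mult.assoc) (rule sum.swap)
      also have "\<dots> = 0"
        by (rule sum.neutral) (simp add: Py)
      finally show ?thesis .
    qed
    moreover have "d' l \<noteq> 0" for l
      by (simp add: d'_def supp_def)
    ultimately have "(\<Sum>i<n. P $$ (i, l) * x i) = 0" if "l < n" for l
      using that by (auto simp: y_def)
    then show "x i = 0"
      using invertible_mat_inj[OF P _ i] by blast
  qed
  then have "n = vec_space.rank n (A + ?B Z (\<lambda>_. 1))"
    unfolding sum_eq by (subst (asm) vec_space.det_rank_iff[of _ n]) auto
  also have "\<dots> \<le> vec_space.rank n A + vec_space.rank n (?B Z (\<lambda>_. 1))"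
    by (rule vec_space.rank_subadditive) (use A in auto)
  also have "vec_space.rank n (?B Z (\<lambda>_. 1)) \<le> card Z"
    by (rule rank_sum_rank_one_le) (simp add: Z_def)
  also have "card Z = n - card (supp n d)"
    unfolding Z_def using supp_subset by (subst card_Diff_subset) auto
  finally show ?thesis
    using le card_mono[OF _ supp_subset, of n d] by simp
qed

section \<open>Rank and character from a diagonalization\<close>

text \<open>No normal form is imposed on the diagonalization, so that the one obtained for a border can be
  used as it stands; the product of its nonzero entries decides the character.\<close>

definition form_type :: "nat \<Rightarrow> 'a::field mat \<Rightarrow> nat \<Rightarrow> int \<Rightarrow> bool" where
  "form_type n A r \<psi> \<longleftrightarrow>
     (\<exists>P d. diagonalizes n A P d \<and> card (supp n d) = r \<and> (\<Prod>l\<in>supp n d. qchar (d l)) = \<psi>)"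

lemma repnum_Un_zero:
  fixes e :: "'i \<Rightarrow> 'a::{field,finite}"
  assumes "finite Z" "finite R" "R \<inter> Z = {}" "\<And>l. l \<in> Z \<Longrightarrow> e l = 0"
  shows "repnum (R \<union> Z) e c = CARD('a) ^ card Z * repnum R e c"
  using assms
proof (induction Z rule: finite_induct)
  case (insert z Z)
  then have "repnum (insert z (R \<union> Z)) e c = CARD('a) * repnum (R \<union> Z) e c"
    by (subst repnum_insert) auto
  with insert show ?case by simp
qed simp

text \<open>The left-hand side does not mention the diagonalization. This is what makes the representation
  numbers of the diagonal form invariants of \<open>A\<close>.\<close>

lemma card_form_values:
  fixes A :: "'a::{field,finite} mat"
  assumes diag: "diagonalizes n A P d"
  shows "card {x \<in> {..<n} \<rightarrow>\<^sub>E UNIV. (\<Sum>i<n. \<Sum>k<n. x i * A $$ (i, k) * x k) = c}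
    = CARD('a) ^ (n - card (supp n d)) * repnum (supp n d) d c"
proof -
  have P: "P \<in> carrier_mat n n" "invertible_mat P"
    and entry: "\<And>i k. i < n \<Longrightarrow> k < n \<Longrightarrow> A $$ (i, k) = (\<Sum>l<n. P $$ (i, l) * d l * P $$ (k, l))"
    using diag by (auto simp: diagonalizes_def)
  let ?T = "apply_mat n (\<lambda>l i. P $$ (i, l))"
  obtain Q where Q: "\<And>i k. i < n \<Longrightarrow> k < n \<Longrightarrow> (\<Sum>l<n. P $$ (i, l) * Q $$ (l, k)) = (if i = k then 1 else 0)"
    "\<And>i k. i < n \<Longrightarrow> k < n \<Longrightarrow> (\<Sum>l<n. Q $$ (i, l) * P $$ (l, k)) = (if i = k then 1 else 0)"
    by (rule invertible_matE[OF P]) blast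
  have bij: "bij_betw ?T ({..<n} \<rightarrow>\<^sub>E UNIV) ({..<n} \<rightarrow>\<^sub>E UNIV)"
    by (rule bij_betw_apply_mat[where N = "\<lambda>i l. Q $$ (l, i)"])
       (use Q in \<open>auto simp: mult.commute\<close>)
  have vals: "(\<Sum>i<n. \<Sum>k<n. x i * A $$ (i, k) * x k) = (\<Sum>l<n. d l * (?T x l)\<^sup>2)" for x
  proof -
    have "(\<Sum>i<n. \<Sum>k<n. x i * A $$ (i, k) * x k)
        = (\<Sum>i<n. \<Sum>k<n. \<Sum>l<n. d l * ((P $$ (i, l) * x i) * (P $$ (k, l) * x k)))"
      by (intro sum.cong refl) (simp add: entry sum_distrib_left sum_distrib_right mult_ac)
    also have "\<dots> = (\<Sum>i<n. \<Sum>l<n. \<Sum>k<n. d l * ((P $$ (i, l) * x i) * (P $$ (k, l) * x k)))"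
      by (rule sum.cong[OF refl]) (rule sum.swap)
    also have "\<dots> = (\<Sum>l<n. \<Sum>i<n. \<Sum>k<n. d l * ((P $$ (i, l) * x i) * (P $$ (k, l) * x k)))"
      by (rule sum.swap)
    also have "\<dots> = (\<Sum>l<n. d l * (?T x l)\<^sup>2)"
      by (intro sum.cong refl)
         (simp add: apply_mat_def power2_eq_square sum_product flip: sum_distrib_left)
    finally show ?thesis .
  qed
  have "bij_betw ?T {x \<in> {..<n} \<rightarrow>\<^sub>E UNIV. (\<Sum>l<n. d l * (?T x l)\<^sup>2) = c}
      {X \<in> {..<n} \<rightarrow>\<^sub>E UNIV. (\<Sum>l<n. d l * (X l)\<^sup>2) = c}"
    by (rule bij_betw_Collect[OF bij]) simp
  then have "card {x \<in> {..<n} \<rightarrow>\<^sub>E UNIV. (\<Sum>i<n. \<Sum>k<n. x i * A $$ (i, k) * x k) = c}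
      = repnum {..<n} d c"
    unfolding vals repnum_def by (rule bij_betw_same_card)
  also have "repnum {..<n} d c = CARD('a) ^ card ({..<n} - supp n d) * repnum (supp n d) d c"
  proof -
    have "repnum (supp n d \<union> ({..<n} - supp n d)) d c
        = CARD('a) ^ card ({..<n} - supp n d) * repnum (supp n d) d c"
      by (rule repnum_Un_zero) (auto simp: supp_def)
    moreover have "supp n d \<union> ({..<n} - supp n d) = {..<n}"
      using supp_subset[of n d] by auto
    ultimately show ?thesis by (simp only:)
  qed
  also have "card ({..<n} - supp n d) = n - card (supp n d)"
    using supp_subset by (subst card_Diff_subset) auto
  finally show ?thesis .
qed

lemma mk_diagonal_entry:
  "i < length ds \<Longrightarrow> k < length ds \<Longrightarrow> mk_diagonal ds $$ (i, k) = (if i = k then ds ! i else 0)"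
proof (induction ds arbitrary: i k)
  case (Cons a ds)
  have "mk_diagonal (a # ds) =
      four_block_mat (mat 1 1 (\<lambda>_. a)) (0\<^sub>m 1 (length ds)) (0\<^sub>m (length ds) 1) (mk_diagonal ds)"
    using mk_diagonal_dim[of ds] by (simp add: mk_diagonal_def Let_def)
  then show ?case
    using Cons.prems Cons.IH[of "i - 1" "k - 1"] mk_diagonal_dim[of ds]
    by (cases i; cases k) auto
qed simp

lemma congruent_diagonal_entry:
  fixes M :: "'a::field mat"
  assumes M: "M \<in> carrier_mat n n" and len: "length ds = n" and ik: "i < n" "k < n"
  shows "(M * mk_diagonal ds * transpose_mat M) $$ (i, k) = (\<Sum>l<n. M $$ (i, l) * ds ! l * M $$ (k, l))"
proof -
  have "(M * mk_diagonal ds) $$ (i, l) = M $$ (i, l) * ds ! l" if "l < n" for l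
  proof -
    have "(M * mk_diagonal ds) $$ (i, l) = (\<Sum>m<n. M $$ (i, m) * mk_diagonal ds $$ (m, l))"
      using that ik M len by (simp add: scalar_prod_def mk_diagonal_dim atLeast0LessThan)
    also have "\<dots> = (\<Sum>m<n. if m = l then M $$ (i, l) * ds ! l else 0)"
      by (rule sum.cong) (use that len in \<open>auto simp: mk_diagonal_entry\<close>)
    finally show ?thesis using that by simp
  qed
  then show ?thesis
    using ik M len by (simp add: scalar_prod_def mk_diagonal_dim atLeast0LessThan)
qed

lemma diagonalizes_iff_mk_diagonal:
  assumes A: "A \<in> carrier_mat n n" and len: "length ds = n"
  shows "diagonalizes n A M (\<lambda>l. ds ! l) \<longleftrightarrow>
    M \<in> carrier_mat n n \<and> invertible_mat M \<and> A = M * mk_diagonal ds * transpose_mat M"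
proof -
  have "A = M * mk_diagonal ds * transpose_mat M \<longleftrightarrow>
      (\<forall>i<n. \<forall>k<n. A $$ (i, k) = (\<Sum>l<n. M $$ (i, l) * ds ! l * M $$ (k, l)))"
    if M: "M \<in> carrier_mat n n"
  proof
    assume "\<forall>i<n. \<forall>k<n. A $$ (i, k) = (\<Sum>l<n. M $$ (i, l) * ds ! l * M $$ (k, l))"
    then show "A = M * mk_diagonal ds * transpose_mat M"
      using M A len by (intro eq_matI) (auto simp: congruent_diagonal_entry simp del: index_mult_mat(1))
  qed (simp add: congruent_diagonal_entry[OF M len])
  then show ?thesis
    by (auto simp: diagonalizes_def)
qed

text \<open>A new choice \<open>P'\<close> of linear forms is admissible if it gives the same quadratic form and the old
  linear forms vanish wherever all the new ones do.\<close>

lemma diagonalizes_change: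
  assumes diag: "diagonalizes n A P d" and P': "P' \<in> carrier_mat n n"
    and entry: "\<And>i k. i < n \<Longrightarrow> k < n \<Longrightarrow>
      (\<Sum>l<n. P' $$ (i, l) * d' l * P' $$ (k, l)) = (\<Sum>l<n. P $$ (i, l) * d l * P $$ (k, l))"
    and inj: "\<And>x l. (\<And>l. l < n \<Longrightarrow> (\<Sum>i<n. P' $$ (i, l) * x i) = 0) \<Longrightarrow> l < n \<Longrightarrow>
      (\<Sum>i<n. P $$ (i, l) * x i) = 0"
  shows "diagonalizes n A P' d'"
proof -
  have "invertible_mat P'"
  proof (rule invertible_matI[OF P'])
    fix x :: "nat \<Rightarrow> 'a" and i
    assume x: "\<And>l. l < n \<Longrightarrow> (\<Sum>i<n. P' $$ (i, l) * x i) = 0" and i: "i < n"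
    show "x i = 0"
      by (rule invertible_mat_inj[of P n x i]) (use diag inj[OF x] i in \<open>auto simp: diagonalizes_def\<close>)
  qed
  then show ?thesis
    using diag P' entry by (simp add: diagonalizes_def)
qed

lemma diagonalizes_permute:
  assumes diag: "diagonalizes n A P d" and \<pi>: "bij_betw \<pi> {..<n} {..<n}"
  shows "diagonalizes n A (mat n n (\<lambda>(i, l). P $$ (i, \<pi> l))) (d \<circ> \<pi>)"
proof (rule diagonalizes_change[OF diag])
  have lt: "l < n \<Longrightarrow> \<pi> l < n" for l
    using bij_betw_apply[OF \<pi>] by auto
  show "(\<Sum>l<n. mat n n (\<lambda>(i, l). P $$ (i, \<pi> l)) $$ (i, l) * (d \<circ> \<pi>) l * mat n n (\<lambda>(i, l). P $$ (i, \<pi> l)) $$ (k, l))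
      = (\<Sum>l<n. P $$ (i, l) * d l * P $$ (k, l))" if "i < n" "k < n" for i k
    using that sum.reindex_bij_betw[OF \<pi>, of "\<lambda>l. P $$ (i, l) * d l * P $$ (k, l)"] by simp
  fix x and l
  assume x: "\<And>l. l < n \<Longrightarrow> (\<Sum>i<n. mat n n (\<lambda>(i, l). P $$ (i, \<pi> l)) $$ (i, l) * x i) = 0" and "l < n"
  then have "l \<in> \<pi> ` {..<n}"
    using bij_betw_imp_surj_on[OF \<pi>] by simp
  then obtain m where "m < n" "l = \<pi> m" by auto
  then show "(\<Sum>i<n. P $$ (i, l) * x i) = 0"
    using x[of m] by simp
qed simp

text \<open>If \<open>b x\<^sup>2 + c y\<^sup>2 = 1\<close> for \<open>b = d\<^sub>j\<close> and \<open>c = d\<^sub>m\<close>, then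
  \<open>b X\<^sub>j\<^sup>2 + c X\<^sub>m\<^sup>2 = (b x X\<^sub>j + c y X\<^sub>m)\<^sup>2 + b c (x X\<^sub>m - y X\<^sub>j)\<^sup>2\<close>, and this substitution has
  determinant \<open>1\<close>.\<close>

lemma diagonalizes_merge:
  assumes diag: "diagonalizes n A P d" and jm: "j < n" "m < n" "j \<noteq> m"
    and one: "d j * x\<^sup>2 + d m * y\<^sup>2 = 1"
  shows "\<exists>P'. diagonalizes n A P' (d(j := 1, m := d j * d m))"
proof -
  define P' where "P' = mat n n (\<lambda>(i, l).
     if l = j then d j * x * P $$ (i, j) + d m * y * P $$ (i, m)
     else if l = m then x * P $$ (i, m) - y * P $$ (i, j) else P $$ (i, l))"
  let ?d = "d(j := 1, m := d j * d m)"
  have split: "(\<Sum>l<n. f l) = f j + f m + (\<Sum>l\<in>{..<n} - {j, m}. f l)" for f :: "nat \<Rightarrow> 'a"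
    using jm sum.subset_diff[of "{j, m}" "{..<n}" f] by (simp add: add.commute)
  have "diagonalizes n A P' ?d"
  proof (rule diagonalizes_change[OF diag])
    fix i k assume ik: "i < n" "k < n"
    have others: "(\<Sum>l\<in>{..<n} - {j, m}. P' $$ (i, l) * ?d l * P' $$ (k, l))
        = (\<Sum>l\<in>{..<n} - {j, m}. P $$ (i, l) * d l * P $$ (k, l))"
      by (rule sum.cong) (use ik in \<open>auto simp: P'_def\<close>)
    have "(d j * x * p + d m * y * p') * (d j * x * s + d m * y * s')
          + (x * p' - y * p) * (d j * d m) * (x * s' - y * s)
        = p * d j * s + p' * d m * s'" for p p' s s'
    proof -
      have "(d j * x * p + d m * y * p') * (d j * x * s + d m * y * s')
          + (x * p' - y * p) * (d j * d m) * (x * s' - y * s)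
          = (d j * x\<^sup>2 + d m * y\<^sup>2) * (p * d j * s + p' * d m * s')"
        by (simp add: algebra_simps power2_eq_square)
      then show ?thesis
        by (simp add: one)
    qed
    then show "(\<Sum>l<n. P' $$ (i, l) * ?d l * P' $$ (k, l)) = (\<Sum>l<n. P $$ (i, l) * d l * P $$ (k, l))"
      unfolding split others using ik jm by (simp add: P'_def)
  next
    fix z and l
    assume z: "\<And>l. l < n \<Longrightarrow> (\<Sum>i<n. P' $$ (i, l) * z i) = 0" and l: "l < n"
    let ?X = "\<lambda>l. \<Sum>i<n. P $$ (i, l) * z i"
    have 1: "d j * x * ?X j + d m * y * ?X m = 0"
      using z[of j] jm by (simp add: P'_def sum_distrib_left sum.distrib algebra_simps)
    have 2: "x * ?X m - y * ?X j = 0"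
      using z[of m] jm by (simp add: P'_def sum_distrib_left sum_subtractf algebra_simps)
    have "?X j = (d j * x\<^sup>2 + d m * y\<^sup>2) * ?X j"
      by (simp add: one)
    also have "\<dots> = x * (d j * x * ?X j + d m * y * ?X m) - d m * y * (x * ?X m - y * ?X j)"
      by (simp add: algebra_simps power2_eq_square)
    finally have "?X j = 0"
      by (simp only: 1 2 mult_zero_right diff_zero)
    have "?X m = (d j * x\<^sup>2 + d m * y\<^sup>2) * ?X m"
      by (simp add: one)
    also have "\<dots> = y * (d j * x * ?X j + d m * y * ?X m) + d j * x * (x * ?X m - y * ?X j)"
      by (simp add: algebra_simps power2_eq_square)
    finally have "?X m = 0"
      by (simp only: 1 2 mult_zero_right add_0)
    note \<open>?X j = 0\<close> this
    moreover have "?X l = 0" if "l \<noteq> j" "l \<noteq> m"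
      using z[OF l] that l by (simp add: P'_def)
    ultimately show "?X l = 0" by blast
  qed (simp add: P'_def)
  then show ?thesis by blast
qed

lemma diagonalizes_scale:
  assumes diag: "diagonalizes n A P d" and m: "m < n" and z: "z \<noteq> 0" "d m = z\<^sup>2 * c"
  shows "\<exists>P'. diagonalizes n A P' (d(m := c))"
proof -
  define P' where "P' = mat n n (\<lambda>(i, l). if l = m then z * P $$ (i, m) else P $$ (i, l))"
  have "diagonalizes n A P' (d(m := c))"
  proof (rule diagonalizes_change[OF diag])
    fix i k assume "i < n" "k < n"
    then show "(\<Sum>l<n. P' $$ (i, l) * (d(m := c)) l * P' $$ (k, l)) = (\<Sum>l<n. P $$ (i, l) * d l * P $$ (k, l))"
      using z by (intro sum.cong) (auto simp: P'_def power2_eq_square mult_ac)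
  next
    fix x and l
    assume x: "\<And>l. l < n \<Longrightarrow> (\<Sum>i<n. P' $$ (i, l) * x i) = 0" and "l < n"
    then show "(\<Sum>i<n. P $$ (i, l) * x i) = 0"
      using x[of l] z by (cases "l = m") (simp_all add: P'_def mult.assoc flip: sum_distrib_left)
  qed (simp add: P'_def)
  then show ?thesis by blast
qed

lemma diagonalizes_cong:
  "diagonalizes n A P d \<Longrightarrow> (\<And>l. l < n \<Longrightarrow> d l = d' l) \<Longrightarrow> diagonalizes n A P d'"
  by (simp add: diagonalizes_def)

lemma diagonalizes_sorted:
  assumes diag: "diagonalizes n A P d"
  shows "\<exists>P' d'. diagonalizes n A P' d' \<and> (\<forall>l<n. d' l \<noteq> 0 \<longleftrightarrow> l < card (supp n d))"
proof -
  let ?r = "card (supp n d)"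
  have r: "?r \<le> n"
    using card_mono[OF _ supp_subset, of n d] by simp
  obtain f where f: "bij_betw f {..<?r} (supp n d)"
    using ex_bij_betw_nat_finite[of "supp n d"] by (auto simp: atLeast0LessThan)
  have "card {?r..<n} = card ({..<n} - supp n d)"
    using supp_subset[of n d] by (subst card_Diff_subset) auto
  then obtain g where g: "bij_betw g {?r..<n} ({..<n} - supp n d)"
    using finite_same_card_bij[of "{?r..<n}" "{..<n} - supp n d"] by auto
  define \<pi> where "\<pi> l = (if l < ?r then f l else g l)" for l
  have "bij_betw \<pi> {..<?r} (supp n d)"
    using f by (rule bij_betw_cong[THEN iffD1, rotated]) (simp add: \<pi>_def)
  moreover have "bij_betw \<pi> {?r..<n} ({..<n} - supp n d)"
    using g by (rule bij_betw_cong[THEN iffD1, rotated]) (simp add: \<pi>_def)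
  ultimately have "bij_betw \<pi> ({..<?r} \<union> {?r..<n}) (supp n d \<union> ({..<n} - supp n d))"
    by (rule bij_betw_combine) auto
  moreover have "{..<?r} \<union> {?r..<n} = {..<n}" "supp n d \<union> ({..<n} - supp n d) = {..<n}"
    using r supp_subset[of n d] by auto
  ultimately have \<pi>: "bij_betw \<pi> {..<n} {..<n}" by simp
  have "(d \<circ> \<pi>) l \<noteq> 0 \<longleftrightarrow> l < ?r" if "l < n" for l
    using that bij_betw_apply[OF f, of l] bij_betw_apply[OF g, of l]
    by (auto simp: \<pi>_def supp_def)
  with diagonalizes_permute[OF diag \<pi>] show ?thesis by blast
qed

lemma card_gt_1: "CARD('a::{field,finite}) > 1"
proof -
  have "card {0, 1 :: 'a} \<le> CARD('a)"
    by (rule card_mono) auto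
  then show ?thesis by simp
qed

context odd_finite_field
begin

text \<open>One target suffices to recover the sign from the representation numbers: \<open>0\<close> in even dimension,
  where the sign enters with the nonzero factor \<open>q - 1\<close>, and \<open>1\<close> in odd dimension.\<close>

lemma qchar_prod_determined:
  fixes d d' :: "'i \<Rightarrow> 'a"
  assumes R: "finite R" "\<forall>l\<in>R. d l \<noteq> 0"
    and S: "finite S" "\<forall>l\<in>S. d' l \<noteq> 0"
    and card: "card R = card S"
    and eq: "\<And>c. repnum R d c = repnum S d' c"
  shows "(\<Prod>l\<in>R. qchar (d l)) = (\<Prod>l\<in>S. qchar (d' l))"
proof -
  let ?q = "int CARD('a)"
  define m where "m = card R div 2"
  have q: "?q > 1" using card_gt_1[where 'a='a] by simp
  have sign: "qchar ((- 1 :: 'a) ^ m) \<noteq> 0" by simp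
  have "qchar ((- 1) ^ m * (\<Prod>l\<in>R. d l)) = qchar ((- 1) ^ m * (\<Prod>l\<in>S. d' l))"
  proof (cases "even (card R)")
    case True
    have "?q ^ m * qchar ((- 1) ^ m * (\<Prod>l\<in>R. d l)) * (?q - 1)
        = ?q ^ m * qchar ((- 1) ^ m * (\<Prod>l\<in>S. d' l)) * (?q - 1)"
      using repnum_formula(1)[OF R, where c = 0] repnum_formula(1)[OF S, where c = 0] True eq[of 0]
      by (auto simp: card m_def)
    then show ?thesis using q by simp
  next
    case False
    have "?q ^ m * qchar ((- 1) ^ m * (\<Prod>l\<in>R. d l)) = ?q ^ m * qchar ((- 1) ^ m * (\<Prod>l\<in>S. d' l))"
      using repnum_formula(2)[OF R, where c = 1] repnum_formula(2)[OF S, where c = 1] False eq[of 1]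
      by (simp add: card m_def)
    then show ?thesis using q by simp
  qed
  then show ?thesis
    using sign by (simp add: qchar_mult qchar_prod)
qed

lemma diagonalizes_unique:
  fixes A :: "'a mat"
  assumes A: "A \<in> carrier_mat n n" and d: "diagonalizes n A P d" "diagonalizes n A P' d'"
  shows "card (supp n d) = card (supp n d')"
    and "(\<Prod>l\<in>supp n d. qchar (d l)) = (\<Prod>l\<in>supp n d'. qchar (d' l))"
proof -
  show card: "card (supp n d) = card (supp n d')"
    using diagonalizes_rank[OF d(1) A] diagonalizes_rank[OF d(2) A] by simp
  have "repnum (supp n d) d c = repnum (supp n d') d' c" for c
    using card_form_values[OF d(1), of c] card_form_values[OF d(2), of c] card by simp
  then show "(\<Prod>l\<in>supp n d. qchar (d l)) = (\<Prod>l\<in>supp n d'. qchar (d' l))"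
    by (intro qchar_prod_determined card) (auto simp: supp_def)
qed

lemma form_type_unique:
  fixes A :: "'a mat"
  assumes "A \<in> carrier_mat n n" "form_type n A r \<psi>" "form_type n A r' \<psi>'"
  shows "r = r'" "\<psi> = \<psi>'"
  using assms diagonalizes_unique unfolding form_type_def by metis+

lemma form_type_iff:
  fixes A :: "'a mat"
  assumes "A \<in> carrier_mat n n" "diagonalizes n A P d"
  shows "form_type n A r \<psi> \<longleftrightarrow> r = card (supp n d) \<and> \<psi> = (\<Prod>l\<in>supp n d. qchar (d l))"
  using assms diagonalizes_unique unfolding form_type_def by metis

lemma form_type_exists:
  fixes A :: "'a mat"
  assumes "sym_mat n A"
  shows "\<exists>r \<psi>. form_type n A r \<psi>"
  using exists_diagonalizes[OF two_neq_zero assms] by (auto simp: form_type_def)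

lemma prod_qchar_sign: 
  assumes "\<And>l. l \<in> R \<Longrightarrow> d l \<noteq> (0 :: 'a)"
  shows "(\<Prod>l\<in>R. qchar (d l)) = 1 \<or> (\<Prod>l\<in>R. qchar (d l)) = - 1"
  using assms
proof (induction R rule: infinite_finite_induct)
  case (insert l R)
  then show ?case using qchar_cases[of "d l"] by auto
qed auto

lemma form_type_sign:
  fixes A :: "'a mat"
  shows "form_type n A r \<psi> \<Longrightarrow> \<psi> = 1 \<or> \<psi> = - 1"
  unfolding form_type_def using prod_qchar_sign[of "supp n _"] by (force simp: supp_def)

lemma form_type_rank:
  fixes A :: "'a mat"
  shows "A \<in> carrier_mat n n \<Longrightarrow> form_type n A r \<psi> \<Longrightarrow> vec_space.rank n A = r"
  unfolding form_type_def using diagonalizes_rank by metis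

text \<open>The number of representations is \<open>q \<plusminus> 1\<close>, hence positive.\<close>

lemma binary_form_represents_1:
  fixes a b :: 'a
  assumes "a \<noteq> 0" "b \<noteq> 0"
  shows "\<exists>x y. a * x\<^sup>2 + b * y\<^sup>2 = 1"
proof -
  let ?d = "\<lambda>l. if l = (0::nat) then a else b" and ?R = "{0, Suc 0}"
  let ?q = "int CARD('a)"
  define s where "s = qchar ((- 1 :: 'a) * (a * b))"
  have "?q * int (repnum ?R ?d 1) = ?q ^ 2 - ?q * s"
  proof -
    have "\<forall>l\<in>?R. ?d l \<noteq> 0" using assms by auto
    from repnum_formula(1)[OF _ this, where c = 1] show ?thesis
      by (simp add: s_def power2_eq_square)
  qed
  also have "\<dots> = ?q * (?q - s)"
    by (simp add: power2_eq_square algebra_simps)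
  finally have "int (repnum ?R ?d 1) = ?q - s" by simp
  moreover have "s \<le> 1"
    unfolding s_def using qchar_cases[of "- 1 * (a * b)"] assms by auto
  ultimately have "repnum ?R ?d 1 \<noteq> 0"
    using card_gt_1[where 'a='a] by auto
  then have "{u \<in> ?R \<rightarrow>\<^sub>E UNIV. (\<Sum>l\<in>?R. ?d l * (u l)\<^sup>2) = 1} \<noteq> {}"
    unfolding repnum_def by (metis card.empty)
  then obtain u where "(\<Sum>l\<in>?R. ?d l * (u l)\<^sup>2) = 1" by blast
  then have "a * (u 0)\<^sup>2 + b * (u 1)\<^sup>2 = 1" by simp
  then show ?thesis by blast
qed

text \<open>The entry at \<open>r - 1\<close> absorbs the others one at a time by \<open>diagonalizes_merge\<close>, each leaving a \<open>1\<close>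
  behind.\<close>

lemma diagonalizes_ones:
  fixes A :: "'a mat"
  assumes diag: "diagonalizes n A P d" and r: "r = card (supp n d)"
  shows "j \<le> r - 1 \<Longrightarrow> \<exists>P' d'. diagonalizes n A P' d' \<and> (\<forall>l<n. d' l \<noteq> 0 \<longleftrightarrow> l < r) \<and> (\<forall>l<j. d' l = 1)"
proof (induction j)
  case 0
  then show ?case using diagonalizes_sorted[OF diag] by (simp add: r)
next
  case (Suc j)
  then obtain P' d' where d': "diagonalizes n A P' d'" "\<forall>l<n. d' l \<noteq> 0 \<longleftrightarrow> l < r" "\<forall>l<j. d' l = 1"
    by auto
  have rn: "r \<le> n"
    unfolding r using card_mono[OF _ supp_subset, of n d] by simp
  have jm: "j < n" "r - 1 < n" "j \<noteq> r - 1" "j < r" "r - 1 < r"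
    using Suc.prems rn by auto
  then have nz: "d' j \<noteq> 0" "d' (r - 1) \<noteq> 0"
    using d'(2) by auto
  obtain x y where "d' j * x\<^sup>2 + d' (r - 1) * y\<^sup>2 = 1"
    using binary_form_represents_1[OF nz] by blast
  from diagonalizes_merge[OF d'(1) jm(1-3) this]
  obtain P'' where "diagonalizes n A P'' (d'(j := 1, r - 1 := d' j * d' (r - 1)))" by blast
  moreover have "\<forall>l<n. (d'(j := 1, r - 1 := d' j * d' (r - 1))) l \<noteq> 0 \<longleftrightarrow> l < r"
    using d'(2) nz jm by auto
  moreover have "\<forall>l<Suc j. (d'(j := 1, r - 1 := d' j * d' (r - 1))) l = 1"
    using d'(3) jm by (auto simp: less_Suc_eq)
  ultimately show ?case by blast
qed

lemma diagonalizes_normal_form: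
  fixes A :: "'a mat"
  assumes diag: "diagonalizes n A P d" and r: "r = card (supp n d)" "r > 0"
  shows "\<exists>P' \<delta>. diagonalizes n A P' (\<lambda>l. if l < r - 1 then 1 else if l = r - 1 then \<delta> else 0)
    \<and> \<delta> \<noteq> 0 \<and> (\<delta> = 1 \<or> \<not> is_square \<delta>)"
proof -
  obtain P' d' where d': "diagonalizes n A P' d'" "\<forall>l<n. d' l \<noteq> 0 \<longleftrightarrow> l < r" "\<forall>l<r - 1. d' l = 1"
    using diagonalizes_ones[OF diag r(1), of "r - 1"] by blast
  have rn: "r \<le> n"
    unfolding r using card_mono[OF _ supp_subset, of n d] by simp
  define \<delta> where "\<delta> = d' (r - 1)"
  have \<delta>: "\<delta> \<noteq> 0"
    using d'(2) rn r(2) by (simp add: \<delta>_def)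
  define D where "D c l = (if l < r - 1 then 1 else if l = r - 1 then c else 0)" for c :: 'a and l
  have D: "diagonalizes n A P' (D \<delta>)"
    by (rule diagonalizes_cong[OF d'(1)]) (use d' rn in \<open>auto simp: D_def \<delta>_def\<close>)
  show ?thesis
  proof (cases "is_square \<delta>")
    case True
    then obtain z where z: "\<delta> = z\<^sup>2" by (auto simp: is_square_iff)
    have "\<exists>P''. diagonalizes n A P'' ((D \<delta>)(r - 1 := 1))"
      by (rule diagonalizes_scale[OF D, of _ z]) (use z \<delta> rn r(2) in \<open>auto simp: D_def\<close>)
    moreover have "(D \<delta>)(r - 1 := 1) = D 1"
      by (auto simp: D_def)
    ultimately have "\<exists>P''. diagonalizes n A P'' (D 1)" by simp
    then show ?thesis
      unfolding D_def by (intro exI[of _ 1] ex_comm[THEN iffD1]) auto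
  next
    case False
    then show ?thesis
      using D \<delta> unfolding D_def by blast
  qed
qed

lemma normal_form_nth:
  assumes "0 < r" "r \<le> n" "l < n"
  shows "(replicate (r - 1) 1 @ [\<delta>] @ replicate (n - r) 0) ! l
    = (if l < r - 1 then 1 else if l = r - 1 then \<delta> else (0 :: 'a))"
  using assms by (auto simp: nth_append nth_Cons')

lemma normal_form_supp:
  assumes r: "0 < r" "r \<le> n" and \<delta>: "\<delta> \<noteq> (0 :: 'a)"
  defines "D \<equiv> \<lambda>l. (replicate (r - 1) 1 @ [\<delta>] @ replicate (n - r) 0) ! l"
  shows "supp n D = {..<r}" and "(\<Prod>l\<in>supp n D. qchar (D l)) = quad_char \<delta>"
proof -
  have D: "D l = (if l < r - 1 then 1 else if l = r - 1 then \<delta> else 0)" if "l < n" for l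
    unfolding D_def by (rule normal_form_nth[OF r that])
  show supp: "supp n D = {..<r}"
    using r \<delta> by (auto simp: supp_def D split: if_splits)
  have "(\<Prod>l\<in>{..<r}. qchar (D l)) = (\<Prod>l\<in>{..<r}. if l = r - 1 then qchar \<delta> else 1)"
    by (rule prod.cong) (use r in \<open>auto simp: D\<close>)
  also have "\<dots> = quad_char \<delta>"
    using r \<delta> by (simp add: qchar_def)
  finally show "(\<Prod>l\<in>supp n D. qchar (D l)) = quad_char \<delta>"
    by (simp add: supp)
qed

text \<open>The character is defined by the normal form \<open>diag(1, \<dots>, 1, \<delta>, 0, \<dots>, 0)\<close>. That normal form is one
  particular diagonalization, so it agrees with any other by \<open>form_type_unique\<close>; for the zero matrix
  the empty product gives the conventional character \<open>1\<close>.\<close>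

lemma rank_has_character_iff_form_type:
  fixes A :: "'a mat"
  assumes sym: "sym_mat n A"
  shows "vec_space.rank n A = r \<and> has_character n A \<psi> \<longleftrightarrow> form_type n A r \<psi>"
proof -
  have A: "A \<in> carrier_mat n n" using sym by (simp add: sym_mat_def)
  obtain P d where diag: "diagonalizes n A P d"
    using exists_diagonalizes[OF two_neq_zero sym] by blast
  have rank: "vec_space.rank n A = card (supp n d)"
    by (rule diagonalizes_rank[OF diag A])
  have rn: "card (supp n d) \<le> n"
    using card_mono[OF _ supp_subset, of n d] by simp
  show ?thesis
  proof (cases "A = 0\<^sub>m n n")
    case True
    then have "card (supp n d) = 0"
      using rank vec_space.rank_0I[of n n, where 'a='a] by simp
    then have "supp n d = {}" by simp
    then show ?thesis
      using True rank form_type_iff[OF A diag] by (auto simp: has_character_def)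
  next
    case False
    have "supp n d \<noteq> {}"
    proof
      assume "supp n d = {}"
      then have "d l = 0" if "l < n" for l
        using that by (auto simp: supp_def)
      then have "A = 0\<^sub>m n n"
        using diag A by (intro eq_matI) (auto simp: diagonalizes_def)
      with False show False ..
    qed
    define s where "s = card (supp n d)"
    have s: "0 < s" "s \<le> n"
      using \<open>supp n d \<noteq> {}\<close> rn by (auto simp: s_def card_gt_0_iff)
    let ?D = "\<lambda>\<delta>. replicate (s - 1) 1 @ [\<delta>] @ replicate (n - s) (0::'a)"
    have len: "length (?D \<delta>) = n" for \<delta>
      using s by simp
    have char: "has_character n A \<psi> \<longleftrightarrow> (\<exists>M \<delta>. diagonalizes n A M (\<lambda>l. ?D \<delta> ! l) \<and>
        \<delta> \<noteq> 0 \<and> (\<delta> = 1 \<or> \<not> is_square \<delta>) \<and> \<psi> = quad_char \<delta>)"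
      unfolding diagonalizes_iff_mk_diagonal[OF A len] has_character_def rank s_def[symmetric] Let_def
        if_not_P[OF False]
      by (intro iffI; elim exE conjE; intro exI conjI; assumption)
    have type: "form_type n A s (quad_char \<delta>)"
      if "diagonalizes n A M (\<lambda>l. ?D \<delta> ! l)" "\<delta> \<noteq> 0" for M \<delta>
      unfolding form_type_def using that normal_form_supp[OF s that(2)]
      by (intro exI[of _ M] exI[of _ "\<lambda>l. ?D \<delta> ! l"] conjI) (simp_all only: card_lessThan)
    obtain M \<delta> where M': "diagonalizes n A M (\<lambda>l. if l < s - 1 then 1 else if l = s - 1 then \<delta> else 0)"
      and \<delta>: "\<delta> \<noteq> 0" "\<delta> = 1 \<or> \<not> is_square \<delta>"
      using diagonalizes_normal_form[OF diag s_def s(1)] by blast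
    have M: "diagonalizes n A M (\<lambda>l. ?D \<delta> ! l)"
      by (rule diagonalizes_cong[OF M']) (rule normal_form_nth[OF s, symmetric])
    have "has_character n A \<psi> \<longleftrightarrow> form_type n A s \<psi>"
      using char M \<delta> type form_type_unique(2)[OF A] by blast
    then show ?thesis
      using rank form_type_rank[OF A] by (auto simp: s_def)
  qed
qed

end

section \<open>Borders of a fixed matrix\<close>

lemma card_PiE_UNIV: "finite R \<Longrightarrow> card (R \<rightarrow>\<^sub>E (UNIV :: 'a::finite set)) = CARD('a) ^ card R"
  by (simp add: card_PiE)

lemma sum_card_fibres:
  assumes "finite X" "finite C"
  shows "card {u \<in> X. g u \<in> C} = (\<Sum>c\<in>C. card {u \<in> X. g u = c})"
proof -
  have "{u \<in> X. g u \<in> C} = (\<Union>c\<in>C. {u \<in> X. g u = c})" by auto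
  then show ?thesis
    using assms by (simp only:) (subst card_UN_disjoint, auto)
qed

lemma sum_repnum:
  fixes e :: "'i \<Rightarrow> 'a::{field,finite}"
  assumes "finite R"
  shows "(\<Sum>c\<in>UNIV. repnum R e c) = CARD('a) ^ card R"
  using sum_card_fibres[of "R \<rightarrow>\<^sub>E UNIV" "UNIV :: 'a set" "\<lambda>u. \<Sum>l\<in>R. e l * (u l)\<^sup>2"] assms
  by (simp add: repnum_def card_PiE_UNIV finite_PiE_UNIV)

lemma border_carrier [simp]: "border n A v a \<in> carrier_mat (Suc n) (Suc n)"
  by (simp add: border_def)

lemma border_cong: "(\<And>i. i < n \<Longrightarrow> v i = w i) \<Longrightarrow> border n A v a = border n A w a"
  by (auto simp: border_def intro!: eq_matI)

context odd_finite_field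
begin

text \<open>\<open>X\<close> consists of the coordinate vectors of the column space. There the vanishing coordinates can be
  dropped, which leaves a form in \<open>card R\<close> variables.\<close>

lemma card_supported_values:
  fixes d :: "nat \<Rightarrow> 'a" and n :: nat
  defines "R \<equiv> supp n d"
  defines "X \<equiv> {u \<in> {..<n} \<rightarrow>\<^sub>E UNIV. \<forall>j<n. d j = 0 \<longrightarrow> u j = 0}"
  shows "card {u \<in> X. (\<Sum>l<n. (u l)\<^sup>2 / d l) \<in> C} = (\<Sum>c\<in>C. repnum R (\<lambda>l. 1 / d l) c)"
    and "card X = CARD('a) ^ card R"
proof -
  have bij: "bij_betw (\<lambda>u. restrict u R) X (R \<rightarrow>\<^sub>E UNIV)"
  proof (rule bij_betw_byWitness[where f' = "\<lambda>w. restrict (\<lambda>l. if l \<in> R then w l else 0) {..<n}"])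
    show "\<forall>u\<in>X. restrict (\<lambda>l. if l \<in> R then restrict u R l else 0) {..<n} = u"
      by (auto simp: X_def R_def supp_def fun_eq_iff PiE_iff extensional_def)
    show "\<forall>w\<in>R \<rightarrow>\<^sub>E UNIV. restrict (restrict (\<lambda>l. if l \<in> R then w l else 0) {..<n}) R = w"
      by (auto simp: R_def supp_def fun_eq_iff PiE_iff extensional_def)
    show "(\<lambda>u. restrict u R) ` X \<subseteq> R \<rightarrow>\<^sub>E UNIV"
      by (intro image_subsetI) simp
    show "(\<lambda>w. restrict (\<lambda>l. if l \<in> R then w l else 0) {..<n}) ` (R \<rightarrow>\<^sub>E UNIV) \<subseteq> X"
      by (intro image_subsetI) (simp add: X_def R_def supp_def)
  qed
  have fin: "finite X"
    unfolding X_def using finite_PiE_UNIV[of "{..<n}", where 'a='a] by simp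
  have Q: "(\<Sum>l<n. (u l)\<^sup>2 / d l) = (\<Sum>l\<in>R. 1 / d l * (restrict u R l)\<^sup>2)" for u :: "nat \<Rightarrow> 'a"
    unfolding R_def by (rule sum.mono_neutral_cong_right) (auto simp: supp_def)
  have "card {u \<in> X. (\<Sum>l<n. (u l)\<^sup>2 / d l) = c} = repnum R (\<lambda>l. 1 / d l) c" for c
    unfolding repnum_def Q by (rule bij_betw_same_card, rule bij_betw_Collect[OF bij]) simp
  then show "card {u \<in> X. (\<Sum>l<n. (u l)\<^sup>2 / d l) \<in> C} = (\<Sum>c\<in>C. repnum R (\<lambda>l. 1 / d l) c)"
    by (subst sum_card_fibres[OF fin]) simp_all
  show "card X = CARD('a) ^ card R"
    using bij_betw_same_card[OF bij] by (simp add: card_PiE_UNIV R_def)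
qed

lemma form_type_border_off_range:
  fixes A :: "'a mat"
  assumes diag: "diagonalizes n A P d"
    and v: "\<forall>i<n. v i = (\<Sum>l<n. P $$ (i, l) * u l)"
    and j: "j < n" "d j = 0" "u j \<noteq> 0"
  shows "form_type (Suc n) (border n A v a) (card (supp n d) + 2)
    ((\<Prod>l\<in>supp n d. qchar (d l)) * qchar (- 1 :: 'a))"
proof -
  note two = two_neq_zero
  let ?d = "d(j := 1 / 2, n := - 1 / 2)"
  obtain P' where P': "diagonalizes (Suc n) (border n A v a) P' ?d"
    using diagonalizes_border_off_range[OF diag v j two] by blast
  have supp: "supp (Suc n) ?d = insert n (insert j (supp n d))"
    using j two by (auto simp: supp_def less_Suc_eq)
  have notin: "j \<notin> supp n d" "n \<notin> insert j (supp n d)"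
    using j by (auto simp: supp_def)
  have "(\<Prod>l\<in>supp n d. qchar (?d l)) = (\<Prod>l\<in>supp n d. qchar (d l))"
    by (rule prod.cong) (use notin in auto)
  moreover have "qchar (1 / 2 :: 'a) * qchar (- 1 / 2 :: 'a) = qchar (- 1 :: 'a)"
  proof -
    have "qchar (- 1 / 2 :: 'a) = qchar (1 / 2 :: 'a) * qchar (- 1 :: 'a)"
      by (simp flip: qchar_mult)
    then show ?thesis
      using qchar_square_self[of "1 / 2 :: 'a"] two by simp
  qed
  ultimately have "(\<Prod>l\<in>supp (Suc n) ?d. qchar (?d l)) = (\<Prod>l\<in>supp n d. qchar (d l)) * qchar (- 1 :: 'a)"
    unfolding supp using notin j by (simp add: mult_ac)
  moreover have "card (supp (Suc n) ?d) = card (supp n d) + 2"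
    unfolding supp using notin by simp
  ultimately show ?thesis
    unfolding form_type_def using P' by blast
qed

lemma form_type_border_in_range:
  fixes A :: "'a mat" and a :: 'a
  assumes diag: "diagonalizes n A P d"
    and v: "\<forall>i<n. v i = (\<Sum>l<n. P $$ (i, l) * u l)"
    and u: "\<forall>l<n. d l = 0 \<longrightarrow> u l = 0"
  defines "c \<equiv> a - (\<Sum>l<n. (u l)\<^sup>2 / d l)"
  shows "c = 0 \<Longrightarrow> form_type (Suc n) (border n A v a) (card (supp n d)) (\<Prod>l\<in>supp n d. qchar (d l))"
    and "c \<noteq> 0 \<Longrightarrow> form_type (Suc n) (border n A v a) (card (supp n d) + 1)
      ((\<Prod>l\<in>supp n d. qchar (d l)) * qchar c)"
proof -
  let ?d = "d(n := c)"
  obtain P' where P': "diagonalizes (Suc n) (border n A v a) P' ?d"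
    using diagonalizes_border_in_range[OF diag v u] unfolding c_def by blast
  have notin: "n \<notin> supp n d"
    by (simp add: supp_def)
  have prod: "(\<Prod>l\<in>supp n d. qchar (?d l)) = (\<Prod>l\<in>supp n d. qchar (d l))"
    by (rule prod.cong) (use notin in auto)
  {
    assume "c = 0"
    then have "supp (Suc n) ?d = supp n d"
      by (auto simp: supp_def less_Suc_eq)
    then show "form_type (Suc n) (border n A v a) (card (supp n d)) (\<Prod>l\<in>supp n d. qchar (d l))"
      unfolding form_type_def using P' prod by metis
  next
    assume "c \<noteq> 0"
    then have supp: "supp (Suc n) ?d = insert n (supp n d)"
      by (auto simp: supp_def less_Suc_eq)
    have "card (supp (Suc n) ?d) = card (supp n d) + 1"
      unfolding supp using notin by simp
    moreover have "(\<Prod>l\<in>supp (Suc n) ?d. qchar (?d l)) = (\<Prod>l\<in>supp n d. qchar (d l)) * qchar c"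
      unfolding supp using notin prod by (simp add: mult.commute)
    ultimately show "form_type (Suc n) (border n A v a) (card (supp n d) + 1)
        ((\<Prod>l\<in>supp n d. qchar (d l)) * qchar c)"
      unfolding form_type_def using P' by blast
  }
qed

text \<open>The substitution \<open>v = P u\<close> is a bijection, and \<open>u\<close> decides the type of the border: it is of rank
  \<open>r + 2\<close> off the column space, and otherwise governed by the difference of \<open>a\<close> and the value of the
  form with coefficients \<open>1 / d\<^sub>l\<close> at \<open>u\<close>. The excluded \<open>\<phi> = 0\<close> would also be taken by
  \<open>\<psi> * qchar (a - c)\<close> at \<open>c = a\<close>.\<close>

lemma card_border_form_type:
  fixes A :: "'a mat"
  assumes diag: "diagonalizes n A P d" and \<phi>: "\<phi> \<noteq> 0"
  defines "R \<equiv> supp n d"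
  defines "r \<equiv> card R" and "\<psi> \<equiv> (\<Prod>l\<in>R. qchar (d l))"
  shows "card {v \<in> {..<n} \<rightarrow>\<^sub>E UNIV. form_type (Suc n) (border n A v a) \<rho> \<phi>} =
    (if \<rho> = r + 2 \<and> \<phi> = \<psi> * qchar (- 1 :: 'a) then CARD('a) ^ n - CARD('a) ^ r
     else if \<rho> = r \<and> \<phi> = \<psi> then repnum R (\<lambda>l. 1 / d l) a
     else if \<rho> = r + 1 then \<Sum>c | \<psi> * qchar (a - c) = \<phi>. repnum R (\<lambda>l. 1 / d l) c
     else 0)"
proof -
  have P: "P \<in> carrier_mat n n" "invertible_mat P"
    using diag by (auto simp: diagonalizes_def)
  let ?V = "{..<n} \<rightarrow>\<^sub>E (UNIV :: 'a set)"
  let ?T = "apply_mat n (\<lambda>i l. P $$ (i, l))"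
  define X where "X = {u \<in> ?V. \<forall>j<n. d j = 0 \<longrightarrow> u j = 0}"
  define Q where "Q u = (\<Sum>l<n. (u l)\<^sup>2 / d l)" for u
  obtain P' where P': "\<And>i k. i < n \<Longrightarrow> k < n \<Longrightarrow> (\<Sum>l<n. P $$ (i, l) * P' $$ (l, k)) = (if i = k then 1 else 0)"
    "\<And>i k. i < n \<Longrightarrow> k < n \<Longrightarrow> (\<Sum>l<n. P' $$ (i, l) * P $$ (l, k)) = (if i = k then 1 else 0)"
    by (rule invertible_matE[OF P]) blast
  have bij: "bij_betw ?T ?V ?V"
    by (rule bij_betw_apply_mat[where N = "\<lambda>i l. P' $$ (i, l)"]) (use P' in auto)
  have T: "\<forall>i<n. ?T u i = (\<Sum>l<n. P $$ (i, l) * u l)" for u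
    by (simp add: apply_mat_def)
  define good where "good u \<longleftrightarrow> (if u \<in> X
      then if Q u = a then \<rho> = r \<and> \<phi> = \<psi> else \<rho> = r + 1 \<and> \<psi> * qchar (a - Q u) = \<phi>
      else \<rho> = r + 2 \<and> \<phi> = \<psi> * qchar (- 1 :: 'a))" for u
  have good_iff: "form_type (Suc n) (border n A (?T u) a) \<rho> \<phi> \<longleftrightarrow> good u" if u: "u \<in> ?V" for u
  proof -
    have unique: "form_type (Suc n) (border n A (?T u) a) \<rho> \<phi> \<longleftrightarrow> \<rho> = r' \<and> \<phi> = \<psi>'"
      if "form_type (Suc n) (border n A (?T u) a) r' \<psi>'" for r' \<psi>'
      using that form_type_unique[OF border_carrier] by blast
    show ?thesis
    proof (cases "u \<in> X")
      case True
      then have u0: "\<forall>l<n. d l = 0 \<longrightarrow> u l = 0"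
        by (simp add: X_def)
      note in_range = form_type_border_in_range[where v = "?T u" and u = u and a = a, OF diag T u0]
      show ?thesis
      proof (cases "Q u = a")
        case eq: True
        then have "form_type (Suc n) (border n A (?T u) a) r \<psi>"
          using in_range(1) unfolding Q_def r_def R_def \<psi>_def by simp
        from unique[OF this] show ?thesis
          by (simp add: good_def eq True)
      next
        case False
        then have "a - Q u \<noteq> 0" by simp
        then have "form_type (Suc n) (border n A (?T u) a) (r + 1) (\<psi> * qchar (a - Q u))"
          unfolding Q_def r_def R_def \<psi>_def by (rule in_range(2))
        from unique[OF this] show ?thesis
          using False by (simp add: good_def True eq_commute[of "\<psi> * _"])
      qed
    next
      case False
      then obtain j where j: "j < n" "d j = 0" "u j \<noteq> 0"
        using u by (auto simp: X_def)
      from unique[OF form_type_border_off_range[where v = "?T u" and u = u, OF diag T j]] False show ?thesis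
        by (simp add: good_def r_def R_def \<psi>_def)
    qed
  qed
  have "card {v \<in> ?V. form_type (Suc n) (border n A v a) \<rho> \<phi>} = card {u \<in> ?V. good u}"
    by (rule bij_betw_same_card[symmetric], rule bij_betw_Collect[OF bij]) (rule good_iff)
  also have "\<dots> = (if \<rho> = r + 2 \<and> \<phi> = \<psi> * qchar (- 1 :: 'a) then CARD('a) ^ n - CARD('a) ^ r
     else if \<rho> = r \<and> \<phi> = \<psi> then repnum R (\<lambda>l. 1 / d l) a
     else if \<rho> = r + 1 then \<Sum>c | \<psi> * qchar (a - c) = \<phi>. repnum R (\<lambda>l. 1 / d l) c
     else 0)"
  proof -
    have XV: "X \<subseteq> ?V" by (auto simp: X_def)
    have finV: "finite ?V" by (rule finite_PiE_UNIV) simp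
    note counts = card_supported_values[of n d, folded X_def R_def Q_def]
    consider "\<rho> = r + 2" "\<phi> = \<psi> * qchar (- 1 :: 'a)" | "\<rho> = r" "\<phi> = \<psi>" | "\<rho> = r + 1"
      | "\<not> (\<rho> = r + 2 \<and> \<phi> = \<psi> * qchar (- 1 :: 'a))" "\<not> (\<rho> = r \<and> \<phi> = \<psi>)" "\<rho> \<noteq> r + 1"
      by blast
    then show ?thesis
    proof cases
      case 1
      then have "{u \<in> ?V. good u} = ?V - X"
        using XV by (auto simp: good_def)
      moreover have "card (?V - X) = CARD('a) ^ n - CARD('a) ^ r"
        using counts(2) XV finV by (simp add: card_Diff_subset finite_subset card_PiE_UNIV r_def)
      ultimately show ?thesis using 1 by simp
    next
      case 2
      then have "{u \<in> ?V. good u} = {u \<in> X. Q u \<in> {a}}"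
        using XV by (auto simp: good_def)
      then show ?thesis
        using 2 counts(1)[of "{a}"] by simp
    next
      case 3
      then have "{u \<in> ?V. good u} = {u \<in> X. Q u \<in> {c. \<psi> * qchar (a - c) = \<phi>}}"
        using XV \<phi> by (auto simp: good_def)
      then show ?thesis
        using 3 counts(1)[of "{c. \<psi> * qchar (a - c) = \<phi>}"] by simp
    next
      case 4
      then have "{u \<in> ?V. good u} = {}"
        by (auto simp: good_def)
      then show ?thesis using 4 by (auto simp only: card.empty if_False)
    qed
  qed
  finally show ?thesis .
qed

end

section \<open>Assembling the borders of all matrices\<close>

definition hollow :: "nat \<Rightarrow> nat \<Rightarrow> 'a::field mat set" where
  "hollow n k = {A. sym_mat n A \<and> (\<forall>i<k. A $$ (i, i) = 0)}"

definition type_count :: "'a::field itself \<Rightarrow> nat \<Rightarrow> nat \<Rightarrow> nat \<Rightarrow> int \<Rightarrow> nat" where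
  "type_count _ n k r \<psi> = card {A :: 'a mat. A \<in> hollow n k \<and> form_type n A r \<psi>}"

lemma bij_betw_border:
  fixes S :: "'a::field set"
  assumes k: "k \<le> n"
  shows "bij_betw (\<lambda>(A, v, a). border n A v a)
    (hollow n k \<times> ({..<n} \<rightarrow>\<^sub>E UNIV) \<times> S) {A :: 'a mat. A \<in> hollow (Suc n) k \<and> A $$ (n, n) \<in> S}"
proof -
  let ?V = "{..<n} \<rightarrow>\<^sub>E (UNIV :: 'a set)"
  let ?b = "\<lambda>(A, v, a). border n A v (a :: 'a)"
  let ?u = "\<lambda>A. (mat n n (\<lambda>(i, j). A $$ (i, j)), restrict (\<lambda>i. A $$ (i, n)) {..<n}, A $$ (n, n) :: 'a)"
  have left: "?u (border n A v a) = (A, v, a)" if A: "A \<in> hollow n k" and v: "v \<in> ?V" for A v a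
  proof -
    have "mat n n (\<lambda>(i, j). border n A v a $$ (i, j)) = A"
      using A by (auto simp: hollow_def sym_mat_def border_def intro!: eq_matI)
    moreover have "restrict (\<lambda>i. border n A v a $$ (i, n)) {..<n} = v"
      using PiE_arb[OF v] by (auto simp: fun_eq_iff border_def restrict_def)
    ultimately show ?thesis
      by (simp add: border_def)
  qed
  have right: "?b (?u A) = A" if A: "A \<in> hollow (Suc n) k" for A
  proof -
    have "?b (?u A) = border n (mat n n (\<lambda>(i, j). A $$ (i, j))) (\<lambda>i. A $$ (i, n)) (A $$ (n, n))"
      unfolding prod.case by (rule border_cong) simp
    also have "\<dots> = A"
      using border_decomposition(2)[of n A] A by (simp add: hollow_def)
    finally show ?thesis .
  qed
  have into: "border n A v a \<in> hollow (Suc n) k \<and> border n A v a $$ (n, n) \<in> S"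
    if A: "A \<in> hollow n k" and a: "a \<in> S" for A v a
  proof -
    have tr: "A $$ (i, j) = A $$ (j, i)" if "i < n" "j < n" for i j
      using A that index_transpose_mat(1)[of i A j] by (auto simp: hollow_def sym_mat_def)
    have "transpose_mat (border n A v a) = border n A v a"
    proof (rule eq_matI)
      fix i j assume "i < dim_row (border n A v a)" "j < dim_col (border n A v a)"
      then show "transpose_mat (border n A v a) $$ (i, j) = border n A v a $$ (i, j)"
        using tr[of i j] by (auto simp: border_def)
    qed (simp_all add: border_def)
    then show ?thesis
      using A a k by (auto simp: hollow_def sym_mat_def border_def)
  qed
  have out: "?u A \<in> hollow n k \<times> ?V \<times> S" if A: "A \<in> hollow (Suc n) k" "A $$ (n, n) \<in> S" for A
    using border_decomposition(1)[of n A] A k by (auto simp: hollow_def)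
  show ?thesis
  proof (rule bij_betw_byWitness[where f' = ?u])
    show "\<forall>z\<in>hollow n k \<times> ?V \<times> S. ?u (?b z) = z"
      by (intro ballI, elim SigmaE) (simp only: prod.case left)
    show "\<forall>A\<in>{A. A \<in> hollow (Suc n) k \<and> A $$ (n, n) \<in> S}. ?b (?u A) = A"
      using right by blast
    show "?b ` (hollow n k \<times> ?V \<times> S) \<subseteq> {A. A \<in> hollow (Suc n) k \<and> A $$ (n, n) \<in> S}"
      by (intro image_subsetI, elim SigmaE) (simp only: prod.case mem_Collect_eq into)
    show "?u ` {A. A \<in> hollow (Suc n) k \<and> A $$ (n, n) \<in> S} \<subseteq> hollow n k \<times> ?V \<times> S"
      using out by blast
  qed
qed

lemma finite_hollow: "finite (hollow n k :: 'a::{field,finite} mat set)"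
proof -
  have "finite (hollow n 0 :: 'a mat set)"
  proof (induction n)
    case 0
    have "hollow 0 0 \<subseteq> {1\<^sub>m 0 :: 'a mat}"
      by (auto simp: hollow_def sym_mat_def intro!: eq_matI)
    then show ?case
      by (rule finite_subset) simp
  next
    case (Suc n)
    have "finite ({..<n} \<rightarrow>\<^sub>E (UNIV :: 'a set))"
      by (rule finite_PiE_UNIV) simp
    then have "finite ((hollow n 0 :: 'a mat set) \<times> ({..<n} \<rightarrow>\<^sub>E (UNIV :: 'a set)) \<times> (UNIV :: 'a set))"
      using Suc by (intro finite_cartesian_product) auto
    then show ?case
      using bij_betw_finite[OF bij_betw_border[of 0 n "UNIV :: 'a set"]] by simp
  qed
  moreover have "hollow n k \<subseteq> (hollow n 0 :: 'a mat set)"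
    by (auto simp: hollow_def)
  ultimately show ?thesis
    by (rule finite_subset[rotated])
qed

text \<open>The corner entry is confined to \<open>S\<close>: the recursions need the whole field and \<open>{0}\<close>.\<close>

lemma card_hollow_border:
  fixes S :: "'a::{field,finite} set"
  assumes k: "k \<le> n"
  shows "card {A. A \<in> hollow (Suc n) k \<and> A $$ (n, n) \<in> S \<and> form_type (Suc n) A \<rho> \<phi>}
    = (\<Sum>A\<in>hollow n k. \<Sum>a\<in>S. card {v \<in> {..<n} \<rightarrow>\<^sub>E UNIV. form_type (Suc n) (border n A v a) \<rho> \<phi>})"
proof -
  let ?V = "{..<n} \<rightarrow>\<^sub>E (UNIV :: 'a set)"
  let ?T = "\<lambda>A a. {v \<in> ?V. form_type (Suc n) (border n A v a) \<rho> \<phi>}"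
  have fin: "finite ?V" by (rule finite_PiE_UNIV) simp
  have "card {A. A \<in> hollow (Suc n) k \<and> A $$ (n, n) \<in> S \<and> form_type (Suc n) A \<rho> \<phi>}
      = card {A \<in> {A. A \<in> hollow (Suc n) k \<and> A $$ (n, n) \<in> S}. form_type (Suc n) A \<rho> \<phi>}"
    by (rule arg_cong[where f = card]) auto
  also have "\<dots> = card {z \<in> hollow n k \<times> ?V \<times> S. form_type (Suc n) (case z of (A, v, a) \<Rightarrow> border n A v a) \<rho> \<phi>}"
    by (rule bij_betw_same_card[symmetric], rule bij_betw_Collect[OF bij_betw_border[OF k]]) simp
  also have "\<dots> = card (Sigma (hollow n k) (\<lambda>A. Sigma S (\<lambda>a. ?T A a)))"
    by (rule bij_betw_same_card, rule bij_betw_byWitness[where f = "\<lambda>(A, v, a). (A, a, v)"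
          and f' = "\<lambda>(A, a, v). (A, v, a)"]) auto
  also have "\<dots> = (\<Sum>A\<in>hollow n k. \<Sum>a\<in>S. card (?T A a))"
    using fin by (subst card_SigmaI) (auto simp: finite_hollow card_SigmaI intro!: sum.cong)
  finally show ?thesis .
qed

lemma diagonalizes_permute_rows:
  assumes diag: "diagonalizes n A P d" and \<sigma>: "bij_betw \<sigma> {..<n} {..<n}"
  shows "diagonalizes n (mat n n (\<lambda>(i, j). A $$ (\<sigma> i, \<sigma> j))) (mat n n (\<lambda>(i, l). P $$ (\<sigma> i, l))) d"
proof -
  have P: "P \<in> carrier_mat n n" "invertible_mat P"
    and entry: "\<And>i k. i < n \<Longrightarrow> k < n \<Longrightarrow> A $$ (i, k) = (\<Sum>l<n. P $$ (i, l) * d l * P $$ (k, l))"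
    using diag by (auto simp: diagonalizes_def)
  have lt: "i < n \<Longrightarrow> \<sigma> i < n" for i
    using bij_betw_apply[OF \<sigma>] by auto
  define \<tau> where "\<tau> = inv_into {..<n} \<sigma>"
  have \<tau>: "bij_betw \<tau> {..<n} {..<n}" "\<And>i. i < n \<Longrightarrow> \<tau> (\<sigma> i) = i"
    unfolding \<tau>_def using \<sigma> by (auto simp: bij_betw_inv_into bij_betw_inv_into_left[OF \<sigma>])
  have "invertible_mat (mat n n (\<lambda>(i, l). P $$ (\<sigma> i, l)))"
  proof (rule invertible_matI)
    fix x :: "nat \<Rightarrow> 'a" and i
    assume x: "\<And>l. l < n \<Longrightarrow> (\<Sum>i<n. mat n n (\<lambda>(i, l). P $$ (\<sigma> i, l)) $$ (i, l) * x i) = 0" and i: "i < n"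
    have "(\<Sum>i<n. P $$ (i, l) * x (\<tau> i)) = 0" if "l < n" for l
    proof -
      have "(\<Sum>i<n. P $$ (i, l) * x (\<tau> i)) = (\<Sum>i<n. P $$ (\<sigma> i, l) * x (\<tau> (\<sigma> i)))"
        by (rule sum.reindex_bij_betw[OF \<sigma>, symmetric])
      also have "\<dots> = 0"
        using x[OF that] that by (simp add: \<tau>(2))
      finally show ?thesis .
    qed
    then have "x (\<tau> (\<sigma> i)) = 0"
      using invertible_mat_inj[OF P, of "\<lambda>i. x (\<tau> i)" "\<sigma> i"] lt[OF i] by blast
    then show "x i = 0"
      using \<tau>(2)[OF i] by simp
  qed simp
  then show ?thesis
    by (auto simp: diagonalizes_def entry lt)
qed

lemma form_type_permute_rows:
  "form_type n A r \<psi> \<Longrightarrow> bij_betw \<sigma> {..<n} {..<n} \<Longrightarrow>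
    form_type n (mat n n (\<lambda>(i, j). A $$ (\<sigma> i, \<sigma> j))) r \<psi>"
  unfolding form_type_def using diagonalizes_permute_rows by blast

text \<open>Interchanging the indices \<open>k\<close> and \<open>n\<close> is a congruence and keeps the first \<open>k\<close> diagonal entries,
  so the additional zero may as well be required in the corner of the border.\<close>

lemma type_count_swap:
  assumes k: "k \<le> n"
  shows "type_count TYPE('a::field) (Suc n) (Suc k) \<rho> \<phi> =
    card {A :: 'a mat. A \<in> hollow (Suc n) k \<and> A $$ (n, n) \<in> {0} \<and> form_type (Suc n) A \<rho> \<phi>}"
proof -
  define \<sigma> where "\<sigma> i = (if i = k then n else if i = n then k else i)" for i
  have \<sigma>2: "\<sigma> (\<sigma> i) = i" for i
    by (simp add: \<sigma>_def)
  have lt: "i < Suc n \<Longrightarrow> \<sigma> i < Suc n" for i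
    using k by (simp add: \<sigma>_def)
  have bij: "bij_betw \<sigma> {..<Suc n} {..<Suc n}"
    by (rule bij_betw_byWitness[where f' = \<sigma>]) (use lt in \<open>auto simp: \<sigma>2\<close>)
  let ?s = "\<lambda>A :: 'a mat. mat (Suc n) (Suc n) (\<lambda>(i, j). A $$ (\<sigma> i, \<sigma> j))"
  have ss: "?s (?s A) = A" if "A \<in> carrier_mat (Suc n) (Suc n)" for A
    using that by (intro eq_matI) (auto simp: lt \<sigma>2)
  have sym: "sym_mat (Suc n) (?s A)" if "sym_mat (Suc n) A" for A
  proof -
    have A: "A \<in> carrier_mat (Suc n) (Suc n)" "transpose_mat A = A"
      using that by (auto simp: sym_mat_def)
    have "A $$ (i, j) = A $$ (j, i)" if "i < Suc n" "j < Suc n" for i j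
      using A that index_transpose_mat(1)[of i A j] by auto
    then show ?thesis
      by (auto simp: sym_mat_def lt intro!: eq_matI)
  qed
  show ?thesis
    unfolding type_count_def
  proof (rule bij_betw_same_card, rule bij_betw_byWitness[where f = ?s and f' = ?s], goal_cases)
    case 1
    then show ?case
      using ss by (auto simp: hollow_def sym_mat_def)
  next
    case 2
    then show ?case
      using ss by (auto simp: hollow_def sym_mat_def)
  next
    case 3
    have "?s A $$ (i, i) = 0" if "\<forall>i<Suc k. A $$ (i, i) = 0" "i < k" for A i
      using that k by (simp add: \<sigma>_def)
    moreover have "?s A $$ (n, n) = 0" if "\<forall>i<Suc k. A $$ (i, i) = 0" for A
      using that k by (simp add: \<sigma>_def)
    ultimately show ?case
      using sym form_type_permute_rows[OF _ bij] by (auto simp: hollow_def)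
  next
    case 4
    have "?s A $$ (i, i) = 0" if "\<forall>i<k. A $$ (i, i) = 0" "A $$ (n, n) = 0" "i < Suc k" for A i
    proof -
      have "?s A $$ (i, i) = A $$ (\<sigma> i, \<sigma> i)"
        using that k by simp
      then show ?thesis
        using that k by (auto simp: \<sigma>_def less_Suc_eq)
    qed
    then show ?case
      using sym form_type_permute_rows[OF _ bij] by (auto simp: hollow_def)
  qed
qed

context odd_finite_field
begin

text \<open>For the coefficients \<open>1 / d\<^sub>l\<close> of \<open>card_border_form_type\<close>, \<open>S a\<close> counts the borders with corner \<open>a\<close>
  whose rank grows by one and whose character is \<open>\<phi>\<close>. Summed over all \<open>a\<close>, each vector contributes
  the \<open>(q - 1) / 2\<close> values of \<open>a - c\<close> in the right square class. For \<open>a = 0\<close> the square class of \<open>c\<close>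
  itself is fixed, and the error terms add up: in even dimension they do not depend on \<open>c \<noteq> 0\<close>, and
  in odd dimension they depend only on its class.\<close>

lemma sum_repnum_shifted:
  fixes e :: "'i \<Rightarrow> 'a"
  assumes R: "finite R" "\<forall>l\<in>R. e l \<noteq> 0" and \<phi>: "\<phi> = 1 \<or> \<phi> = - 1" 
  defines "\<psi> \<equiv> (\<Prod>l\<in>R. qchar (e l))" and "q \<equiv> int CARD('a)" and "\<epsilon> \<equiv> qchar (- 1 :: 'a)"
  defines "S \<equiv> \<lambda>a. int (\<Sum>c | \<psi> * qchar (a - c) = \<phi>. repnum R e c)"
  shows "2 * (\<Sum>a\<in>UNIV. S a) = q ^ card R * (q - 1)"
    and "card R = 2 * m \<Longrightarrow> 2 * (q * S 0) = (q - 1) * (q ^ (2 * m) - q ^ m * \<epsilon> ^ m * \<psi>)"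
    and "card R = 2 * m + 1 \<Longrightarrow> 2 * (q * S 0) = (q - 1) * (q ^ (2 * m + 1) + q ^ Suc m * \<epsilon> ^ Suc m * \<phi>)"
proof -
  have \<psi>: "\<psi> = 1 \<or> \<psi> = - 1"
    unfolding \<psi>_def by (rule prod_qchar_sign) (use R in auto)
  have \<epsilon>: "\<epsilon> = 1 \<or> \<epsilon> = - 1"
    unfolding \<epsilon>_def by (rule qchar_cases) simp
  have prod: "qchar ((- 1) ^ m * (\<Prod>l\<in>R. e l)) = \<epsilon> ^ m * \<psi>" for m
    by (simp add: qchar_mult qchar_prod qchar_power \<epsilon>_def \<psi>_def)
  show "2 * (\<Sum>a\<in>UNIV. S a) = q ^ card R * (q - 1)"
  proof -
    have "(\<Sum>a\<in>UNIV. S a) = (\<Sum>a\<in>UNIV. \<Sum>c\<in>UNIV. if \<psi> * qchar (a - c) = \<phi> then int (repnum R e c) else 0)"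
      unfolding S_def of_nat_sum by (intro sum.cong[OF refl] sum.mono_neutral_cong_left) auto
    also have "\<dots> = (\<Sum>c\<in>UNIV. \<Sum>a\<in>UNIV. if \<psi> * qchar (a - c) = \<phi> then int (repnum R e c) else 0)"
      by (rule sum.swap)
    also have "\<dots> = (\<Sum>c\<in>UNIV. int (repnum R e c) * int (card {a. \<psi> * qchar (a - c) = \<phi>}))"
      by (intro sum.cong[OF refl]) (simp add: sum.If_cases mult.commute)
    finally have "2 * (\<Sum>a\<in>UNIV. S a) = (\<Sum>c\<in>UNIV. int (repnum R e c) * (2 * int (card {a. \<psi> * qchar (a - c) = \<phi>})))"
      by (simp add: sum_distrib_left mult_ac)
    also have "\<dots> = (\<Sum>c\<in>UNIV. int (repnum R e c) * (q - 1))"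
    proof (rule sum.cong[OF refl])
      fix c :: 'a
      have "card {a. \<psi> * qchar (a - c) = \<phi>} = card {x. qchar (x :: 'a) = \<psi> * \<phi>}"
        by (rule bij_betw_same_card, rule bij_betw_byWitness[where f = "\<lambda>a. a - c" and f' = "\<lambda>x. x + c"])
           (use \<psi> in auto)
      then show "int (repnum R e c) * (2 * int (card {a. \<psi> * qchar (a - c) = \<phi>})) = int (repnum R e c) * (q - 1)"
        using card_qchar_eq[of "\<psi> * \<phi>"] \<psi> \<phi> by (auto simp: q_def)
    qed
    also have "\<dots> = q ^ card R * (q - 1)"
      by (simp add: sum_distrib_right[symmetric] of_nat_sum[symmetric] sum_repnum[OF R(1)] q_def del: of_nat_sum)
    finally show ?thesis .
  qed
  define C where "C = {c :: 'a. \<psi> * qchar (0 - c) = \<phi>}"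
  have C_char: "qchar c = \<epsilon> * \<psi> * \<phi>" if "c \<in> C" for c
  proof -
    have "qchar (- c) = \<epsilon> * qchar c"
      using qchar_mult[of "- 1" c] by (simp add: \<epsilon>_def)
    then show ?thesis
      using that \<psi> \<epsilon> by (auto simp: C_def)
  qed
  have "card C = card {x. qchar (x :: 'a) = \<psi> * \<phi>}"
    unfolding C_def
    by (rule bij_betw_same_card, rule bij_betw_byWitness[where f = uminus and f' = uminus]) (use \<psi> in auto)
  then have card_C: "2 * int (card C) = q - 1"
    using card_qchar_eq[of "\<psi> * \<phi>"] \<psi> \<phi> by (auto simp: q_def)
  have S0: "S 0 = (\<Sum>c\<in>C. int (repnum R e c))"
    by (simp add: S_def C_def)
  have C0: "0 \<notin> C"
    using \<phi> by (auto simp: C_def)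
  show "2 * (q * S 0) = (q - 1) * (q ^ (2 * m) - q ^ m * \<epsilon> ^ m * \<psi>)" if m: "card R = 2 * m"
  proof -
    have "q * S 0 = (\<Sum>c\<in>C. q * int (repnum R e c))"
      by (simp add: S0 sum_distrib_left)
    also have "\<dots> = (\<Sum>c\<in>C. q ^ (2 * m) - q ^ m * \<epsilon> ^ m * \<psi>)"
      by (rule sum.cong[OF refl]) (use repnum_formula(1)[OF R] C0 m prod in \<open>auto simp: q_def\<close>)
    finally have "2 * (q * S 0) = (2 * int (card C)) * (q ^ (2 * m) - q ^ m * \<epsilon> ^ m * \<psi>)"
      by simp
    then show ?thesis by (simp only: card_C)
  qed
  show "2 * (q * S 0) = (q - 1) * (q ^ (2 * m + 1) + q ^ Suc m * \<epsilon> ^ Suc m * \<phi>)" if m: "card R = 2 * m + 1"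
  proof -
    have "int (repnum R e c) = q ^ (2 * m) + q ^ m * \<epsilon> ^ Suc m * \<phi>" if c: "c \<in> C" for c
    proof -
      have "qchar ((- 1) ^ m * c * (\<Prod>l\<in>R. e l)) = qchar ((- 1) ^ m * (\<Prod>l\<in>R. e l)) * qchar c"
        by (simp add: qchar_mult)
      also have "\<dots> = \<epsilon> ^ Suc m * \<phi>"
        unfolding prod C_char[OF c] using \<psi> by auto
      finally show ?thesis
        using repnum_formula(2)[OF R, of c] m by (simp add: q_def)
    qed
    then have "S 0 = int (card C) * (q ^ (2 * m) + q ^ m * \<epsilon> ^ Suc m * \<phi>)"
      by (simp add: S0)
    then have "2 * (q * S 0) = (2 * int (card C)) * (q * (q ^ (2 * m) + q ^ m * \<epsilon> ^ Suc m * \<phi>))"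
      by simp
    then show ?thesis
      unfolding card_C by (simp add: algebra_simps)
  qed
qed

end

section \<open>Recursions for the numbers of matrices\<close>

context odd_finite_field
begin

text \<open>The numbers of borders of a fixed matrix \<open>A\<close>, written with indicators of the type of \<open>A\<close> so that
  they can be summed over all \<open>A\<close>. In the two excess formulas the borders of rank \<open>r + 2\<close> cancel,
  because their type does not depend on \<open>a\<close>.\<close>

lemma border_fibre:
  fixes A :: "'a mat"
  assumes sym: "sym_mat n A" and \<phi>: "\<phi> = 1 \<or> \<phi> = - 1"
  defines "q \<equiv> int CARD('a)" and "\<epsilon> \<equiv> qchar (- 1 :: 'a)"
  defines "ft \<equiv> \<lambda>r \<psi>. of_bool (form_type n A r \<psi>) :: int"
  defines "F \<equiv> \<lambda>\<rho> a. int (card {v \<in> {..<n} \<rightarrow>\<^sub>E UNIV. form_type (Suc n) (border n A v a) \<rho> \<phi>})"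
  shows border_fibre_total: "2 * (\<Sum>a\<in>UNIV. F \<rho> a) = 2 * q ^ \<rho> * ft \<rho> \<phi>
      + (if \<rho> \<ge> 1 then q ^ (\<rho> - 1) * (q - 1) * (ft (\<rho> - 1) 1 + ft (\<rho> - 1) (- 1)) else 0)
      + (if \<rho> \<ge> 2 then 2 * q * (q ^ n - q ^ (\<rho> - 2)) * ft (\<rho> - 2) (\<phi> * \<epsilon>) else 0)" (is ?total)
    and border_fibre_excess_even: "2 * (q * F (2 * m + 2) 0 - (\<Sum>a\<in>UNIV. F (2 * m + 2) a))
      = (q - 1) * q ^ Suc m * \<epsilon> ^ Suc m * \<phi> * (2 * ft (2 * m + 2) \<phi> + ft (2 * m + 1) 1 + ft (2 * m + 1) (- 1))"
      (is ?even)
    and border_fibre_excess_odd: "2 * (q * F (2 * m + 1) 0 - (\<Sum>a\<in>UNIV. F (2 * m + 1) a))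
      = - ((q - 1) * q ^ m * \<epsilon> ^ m * (ft (2 * m) 1 - ft (2 * m) (- 1)))" (is ?odd)
proof -
  have A: "A \<in> carrier_mat n n" using sym by (simp add: sym_mat_def)
  obtain P d where diag: "diagonalizes n A P d"
    using exists_diagonalizes[OF two_neq_zero sym] by blast
  define R where "R = supp n d"
  define r where "r = card R"
  define \<psi> where "\<psi> = (\<Prod>l\<in>R. qchar (d l))"
  have R: "finite R" "\<forall>l\<in>R. 1 / d l \<noteq> 0"
    by (auto simp: R_def supp_def)
  have \<psi>_inv: "(\<Prod>l\<in>R. qchar (1 / d l)) = \<psi>"
    unfolding \<psi>_def by (simp add: divide_inverse qchar_inverse)
  have \<psi>: "\<psi> = 1 \<or> \<psi> = - 1"
    unfolding \<psi>_def by (rule prod_qchar_sign) (simp add: R_def supp_def)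
  have \<epsilon>: "\<epsilon> = 1 \<or> \<epsilon> = - 1"
    unfolding \<epsilon>_def by (rule qchar_cases) simp
  have rn: "r \<le> n"
    unfolding r_def R_def using card_mono[OF _ supp_subset, of n d] by simp
  have ft: "ft x y = of_bool (x = r \<and> y = \<psi>)" for x y
    unfolding ft_def form_type_iff[OF A diag] r_def \<psi>_def R_def ..
  define N where "N a = int (repnum R (\<lambda>l. 1 / d l) a)" for a
  define S where "S a = int (\<Sum>c | \<psi> * qchar (a - c) = \<phi>. repnum R (\<lambda>l. 1 / d l) c)" for a
  have qr: "int (CARD('a) ^ n - CARD('a) ^ r) = q ^ n - q ^ r"
    using rn by (simp add: q_def of_nat_diff power_increasing Suc_leI)
  have F: "F \<rho> a = of_bool (\<rho> = r + 2 \<and> \<phi> = \<psi> * \<epsilon>) * (q ^ n - q ^ r)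
      + of_bool (\<rho> = r \<and> \<phi> = \<psi>) * N a + of_bool (\<rho> = r + 1) * S a" for \<rho> a
  proof -
    have "\<phi> \<noteq> 0" using \<phi> by auto
    note count = card_border_form_type[OF diag this, folded R_def, folded r_def \<psi>_def \<epsilon>_def]
    show ?thesis
      unfolding F_def count
      by (simp only: N_def S_def qr[symmetric] of_bool_def split: if_split) auto
  qed
  have sum_N: "(\<Sum>a\<in>UNIV. N a) = q ^ r"
    using sum_repnum[OF R(1), of "\<lambda>l. 1 / d l"] unfolding N_def r_def q_def by (metis of_nat_power of_nat_sum)
  note S_facts = sum_repnum_shifted[OF R \<phi>, unfolded \<psi>_inv, folded S_def q_def \<epsilon>_def r_def]
  have sum_F: "2 * (\<Sum>a\<in>UNIV. F \<rho> a) = of_bool (\<rho> = r + 2 \<and> \<phi> = \<psi> * \<epsilon>) * (2 * q * (q ^ n - q ^ r))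
      + of_bool (\<rho> = r \<and> \<phi> = \<psi>) * (2 * q ^ r) + of_bool (\<rho> = r + 1) * (q ^ r * (q - 1))" for \<rho>
  proof -
    have "2 * (\<Sum>a\<in>UNIV. F \<rho> a) = of_bool (\<rho> = r + 2 \<and> \<phi> = \<psi> * \<epsilon>) * (2 * q * (q ^ n - q ^ r))
      + of_bool (\<rho> = r \<and> \<phi> = \<psi>) * (2 * (\<Sum>a\<in>UNIV. N a)) + of_bool (\<rho> = r + 1) * (2 * (\<Sum>a\<in>UNIV. S a))"
      unfolding F by (simp add: sum.distrib q_def flip: sum_distrib_left)
    then show ?thesis
      unfolding sum_N S_facts(1) .
  qed
  show ?total
  proof -
    have 1: "2 * q ^ \<rho> * ft \<rho> \<phi> = of_bool (\<rho> = r \<and> \<phi> = \<psi>) * (2 * q ^ r)"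
      by (simp add: ft of_bool_def)
    have 2: "(if \<rho> \<ge> 1 then q ^ (\<rho> - 1) * (q - 1) * (ft (\<rho> - 1) 1 + ft (\<rho> - 1) (- 1)) else 0)
        = of_bool (\<rho> = r + 1) * (q ^ r * (q - 1))"
      using \<psi> by (cases \<rho>) (auto simp: ft of_bool_def)
    have "\<phi> * \<epsilon> = \<psi> \<longleftrightarrow> \<phi> = \<psi> * \<epsilon>"
      using \<epsilon> by auto
    moreover have "\<rho> \<ge> 2 \<and> \<rho> - 2 = r \<longleftrightarrow> \<rho> = r + 2"
      by auto
    ultimately have 3: "(if \<rho> \<ge> 2 then 2 * q * (q ^ n - q ^ (\<rho> - 2)) * ft (\<rho> - 2) (\<phi> * \<epsilon>) else 0)
        = of_bool (\<rho> = r + 2 \<and> \<phi> = \<psi> * \<epsilon>) * (2 * q * (q ^ n - q ^ r))"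
      by (auto simp: ft of_bool_def)
    show ?thesis
      unfolding sum_F 1 2 3 by simp
  qed
  have N0_even: "q * N 0 = q ^ (2 * m) + q ^ m * \<epsilon> ^ m * \<psi> * (q - 1)" if "r = 2 * m" for m
    using repnum_formula(1)[OF R, of 0] that
    by (simp add: N_def q_def r_def qchar_mult qchar_prod \<psi>_inv
      qchar_power \<epsilon>_def)
  have N0_odd: "q * N 0 = q ^ r" if "odd r"
    using repnum_formula(2)[OF R, of 0] that
    by (cases r) (simp_all add: N_def q_def r_def)
  have excess: "2 * (q * F \<rho> 0 - (\<Sum>a\<in>UNIV. F \<rho> a)) =
      of_bool (\<rho> = r \<and> \<phi> = \<psi>) * (2 * (q * N 0 - q ^ r))
      + of_bool (\<rho> = r + 1) * (2 * (q * S 0) - q ^ r * (q - 1))" for \<rho>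
    using sum_F[of \<rho>] unfolding F by (simp add: algebra_simps of_bool_def)
  show ?even
  proof (cases "r = 2 * m + 1")
    case True
    then show ?thesis
      unfolding excess ft using S_facts(3)[OF True] \<psi> by (auto simp: algebra_simps)
  next
    case False
    then show ?thesis
      unfolding excess ft using N0_even[of "Suc m"] \<psi> \<phi> by (auto simp: algebra_simps)
  qed
  show ?odd
  proof (cases "r = 2 * m")
    case True
    then show ?thesis
      unfolding excess ft using S_facts(2)[OF True] \<psi> by (auto simp: algebra_simps)
  next
    case False
    then show ?thesis
      unfolding excess ft using N0_odd by auto
  qed
qed

lemma sum_of_bool_form_type:
  "(\<Sum>A\<in>(hollow n k :: 'a mat set). of_bool (form_type n A r \<psi>) :: int) = int (type_count TYPE('a) n k r \<psi>)"
  unfolding type_count_def of_bool_def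
  by (simp add: sum.If_cases finite_hollow Int_def)

lemma type_count_border:
  fixes n k :: nat
  assumes k: "k \<le> n" and \<phi>: "\<phi> = 1 \<or> \<phi> = - 1"
  defines "q \<equiv> int CARD('a)" and "\<epsilon> \<equiv> qchar (- 1 :: 'a)"
  defines "T \<equiv> \<lambda>n k r \<psi>. int (type_count TYPE('a) n k r \<psi>)"
  shows type_count_Suc: "2 * T (Suc n) k \<rho> \<phi> = 2 * q ^ \<rho> * T n k \<rho> \<phi>
      + (if \<rho> \<ge> 1 then q ^ (\<rho> - 1) * (q - 1) * (T n k (\<rho> - 1) 1 + T n k (\<rho> - 1) (- 1)) else 0)
      + (if \<rho> \<ge> 2 then 2 * q * (q ^ n - q ^ (\<rho> - 2)) * T n k (\<rho> - 2) (\<phi> * \<epsilon>) else 0)"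
    and type_count_excess_even: "2 * (q * T (Suc n) (Suc k) (2 * m + 2) \<phi> - T (Suc n) k (2 * m + 2) \<phi>)
      = (q - 1) * q ^ Suc m * \<epsilon> ^ Suc m * \<phi> *
        (2 * T n k (2 * m + 2) \<phi> + T n k (2 * m + 1) 1 + T n k (2 * m + 1) (- 1))"
    and type_count_excess_odd: "2 * (q * T (Suc n) (Suc k) (2 * m + 1) \<phi> - T (Suc n) k (2 * m + 1) \<phi>)
      = - ((q - 1) * q ^ m * \<epsilon> ^ m * (T n k (2 * m) 1 - T n k (2 * m) (- 1)))"
proof -
  define F where "F \<rho> A a = int (card {v \<in> {..<n} \<rightarrow>\<^sub>E UNIV. form_type (Suc n) (border n A v a) \<rho> \<phi>})"
    for \<rho> and A :: "'a mat" and a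
  let ?H = "hollow n k :: 'a mat set"
  have all: "T (Suc n) k \<rho> \<phi> = (\<Sum>A\<in>?H. \<Sum>a\<in>UNIV. F \<rho> A a)" for \<rho>
    using card_hollow_border[OF k, of "UNIV :: 'a set" \<rho> \<phi>]
    by (simp add: T_def type_count_def F_def)
  have zero: "T (Suc n) (Suc k) \<rho> \<phi> = (\<Sum>A\<in>?H. F \<rho> A 0)" for \<rho>
    using card_hollow_border[OF k, of "{0 :: 'a}" \<rho> \<phi>]
    unfolding T_def type_count_swap[OF k] by (simp add: F_def)
  have sym: "sym_mat n A" if "A \<in> ?H" for A :: "'a mat"
    using that by (simp add: hollow_def)
  note fibre = border_fibre[OF sym \<phi>, folded F_def q_def \<epsilon>_def]
  have T: "T n k r \<psi> = (\<Sum>A\<in>?H. of_bool (form_type n A r \<psi>))" for r \<psi>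
    unfolding T_def by (rule sum_of_bool_form_type[symmetric])
  have "2 * T (Suc n) k \<rho> \<phi> = (\<Sum>A\<in>?H. 2 * (\<Sum>a\<in>UNIV. F \<rho> A a))"
    by (simp add: all sum_distrib_left)
  also have "\<dots> = (\<Sum>A\<in>?H. 2 * q ^ \<rho> * of_bool (form_type n A \<rho> \<phi>)
      + (if \<rho> \<ge> 1 then q ^ (\<rho> - 1) * (q - 1) * (of_bool (form_type n A (\<rho> - 1) 1)
          + of_bool (form_type n A (\<rho> - 1) (- 1))) else 0)
      + (if \<rho> \<ge> 2 then 2 * q * (q ^ n - q ^ (\<rho> - 2)) * of_bool (form_type n A (\<rho> - 2) (\<phi> * \<epsilon>)) else 0))"
    by (rule sum.cong[OF refl]) (rule fibre(1))
  finally show "2 * T (Suc n) k \<rho> \<phi> = 2 * q ^ \<rho> * T n k \<rho> \<phi>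
      + (if \<rho> \<ge> 1 then q ^ (\<rho> - 1) * (q - 1) * (T n k (\<rho> - 1) 1 + T n k (\<rho> - 1) (- 1)) else 0)
      + (if \<rho> \<ge> 2 then 2 * q * (q ^ n - q ^ (\<rho> - 2)) * T n k (\<rho> - 2) (\<phi> * \<epsilon>) else 0)"
    unfolding T
    by (cases "\<rho> \<ge> 1"; cases "\<rho> \<ge> 2")
       (simp_all only: sum.distrib if_True if_False sum.neutral_const sum_distrib_left[symmetric] simp_thms)
  have excess: "2 * (q * T (Suc n) (Suc k) \<rho> \<phi> - T (Suc n) k \<rho> \<phi>)
      = (\<Sum>A\<in>?H. 2 * (q * F \<rho> A 0 - (\<Sum>a\<in>UNIV. F \<rho> A a)))" for \<rho>
    by (simp add: all zero sum_distrib_left sum_subtractf right_diff_distrib)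
  have "(\<Sum>A\<in>?H. 2 * (q * F (2 * m + 2) A 0 - (\<Sum>a\<in>UNIV. F (2 * m + 2) A a)))
      = (\<Sum>A\<in>?H. (q - 1) * q ^ Suc m * \<epsilon> ^ Suc m * \<phi> * (2 * of_bool (form_type n A (2 * m + 2) \<phi>)
          + of_bool (form_type n A (2 * m + 1) 1) + of_bool (form_type n A (2 * m + 1) (- 1))))"
    by (rule sum.cong[OF refl]) (rule fibre(2))
  then show "2 * (q * T (Suc n) (Suc k) (2 * m + 2) \<phi> - T (Suc n) k (2 * m + 2) \<phi>)
      = (q - 1) * q ^ Suc m * \<epsilon> ^ Suc m * \<phi> *
        (2 * T n k (2 * m + 2) \<phi> + T n k (2 * m + 1) 1 + T n k (2 * m + 1) (- 1))"
    unfolding excess unfolding T by (simp only: sum.distrib sum_distrib_left[symmetric])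
  have "(\<Sum>A\<in>?H. 2 * (q * F (2 * m + 1) A 0 - (\<Sum>a\<in>UNIV. F (2 * m + 1) A a)))
      = (\<Sum>A\<in>?H. - ((q - 1) * q ^ m * \<epsilon> ^ m * (of_bool (form_type n A (2 * m) 1)
          - of_bool (form_type n A (2 * m) (- 1)))))"
    by (rule sum.cong[OF refl]) (rule fibre(3))
  then show "2 * (q * T (Suc n) (Suc k) (2 * m + 1) \<phi> - T (Suc n) k (2 * m + 1) \<phi>)
      = - ((q - 1) * q ^ m * \<epsilon> ^ m * (T n k (2 * m) 1 - T n k (2 * m) (- 1)))"
    unfolding excess unfolding T by (simp only: sum_subtractf sum_negf sum_distrib_left[symmetric])
qed

lemma form_type_0_iff:
  fixes A :: "'a mat"
  assumes sym: "sym_mat n A"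
  shows "form_type n A 0 \<psi> \<longleftrightarrow> A = 0\<^sub>m n n \<and> \<psi> = 1"
proof -
  have A: "A \<in> carrier_mat n n" using sym by (simp add: sym_mat_def)
  obtain P d where diag: "diagonalizes n A P d"
    using exists_diagonalizes[OF two_neq_zero sym] by blast
  have "supp n d = {} \<longleftrightarrow> A = 0\<^sub>m n n"
  proof
    assume "supp n d = {}"
    then have "d l = 0" if "l < n" for l
      using that by (auto simp: supp_def)
    then show "A = 0\<^sub>m n n"
      using diag A by (intro eq_matI) (auto simp: diagonalizes_def)
  next
    assume "A = 0\<^sub>m n n"
    then have "card (supp n d) = 0"
      using diagonalizes_rank[OF diag A] vec_space.rank_0I[of n n, where 'a='a] by simp
    then show "supp n d = {}" by simp
  qed
  then show ?thesis
    unfolding form_type_iff[OF A diag] by auto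
qed

lemma type_count_rank_0: "type_count TYPE('a) n k 0 \<psi> = of_bool (\<psi> = 1)" if "k \<le> n"
proof -
  have "{A :: 'a mat. A \<in> hollow n k \<and> form_type n A 0 \<psi>} = (if \<psi> = 1 then {0\<^sub>m n n} else {})"
    using form_type_0_iff that by (auto simp: hollow_def sym_mat_def)
  then show ?thesis
    by (simp add: type_count_def)
qed

lemma type_count_0: "type_count TYPE('a) 0 0 r \<psi> = of_bool (r = 0 \<and> \<psi> = 1)"
proof (cases "r = 0")
  case True
  then show ?thesis by (simp add: type_count_rank_0)
next
  case False
  then have "{A :: 'a mat. A \<in> hollow 0 0 \<and> form_type 0 A r \<psi>} = {}"
    by (auto simp: form_type_def supp_def)
  then show ?thesis
    using False by (simp only: type_count_def card.empty) simp
qed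

lemma type_count_rank_1:
  assumes \<phi>: "\<phi> = 1 \<or> \<phi> = - 1" and "k \<le> n"
  shows "2 * int (type_count TYPE('a) n k 1 \<phi>) = int CARD('a) ^ (n - k) - 1"
  using assms(2)
proof (induction k arbitrary: n)
  case 0
  show ?case
  proof (induction n)
    case (Suc n)
    have "2 * int (type_count TYPE('a) (Suc n) 0 1 \<phi>)
        = int CARD('a) * (2 * int (type_count TYPE('a) n 0 1 \<phi>)) + (int CARD('a) - 1)"
      using type_count_Suc[OF _ \<phi>, of 0 n 1] by (simp add: type_count_rank_0)
    then show ?case
      unfolding Suc by (simp add: algebra_simps)
  qed (simp add: type_count_0)
next
  case (Suc k)
  then obtain n' where n: "n = Suc n'" "k \<le> n'"
    by (cases n) auto
  have pos: "int CARD('a) > 0" by simp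
  have "2 * int CARD('a) * int (type_count TYPE('a) n (Suc k) 1 \<phi>)
      = int CARD('a) ^ (Suc n' - k) - int CARD('a)"
    using type_count_excess_odd[OF n(2) \<phi>, of 0] Suc.IH[of n] n
    by (simp add: type_count_rank_0 algebra_simps)
  also have "\<dots> = int CARD('a) * (int CARD('a) ^ (n - Suc k) - 1)"
    using n(2) by (simp add: n(1) Suc_diff_le algebra_simps)
  finally show ?case
    using pos by (simp only: mult.assoc mult.left_commute[of 2] mult_cancel_left) simp
qed

text \<open>Let \<open>N\<close> and \<open>D\<close> be the sum and the difference of the numbers of matrices with character \<open>1\<close> and
  \<open>-1\<close>. In the recursion for \<open>D\<close> the borders whose rank grows by one cancel, so \<open>D\<close> of odd rank
  stays \<open>0\<close>. The recursion for \<open>N\<close> of even rank \<open>2 s\<close> has a term of rank \<open>2 s - 1\<close>; the relation \<open>ratio\<close>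
  between consecutive ranks turns it into a multiple of the term of rank \<open>2 s - 2\<close>, and what results
  is the recursion for \<open>\<epsilon>\<^sup>s q\<^sup>s D\<close>.\<close>

lemma type_count_parity:
  fixes n :: nat
  defines "q \<equiv> int CARD('a)" and "\<epsilon> \<equiv> qchar (- 1 :: 'a)"
  defines "N \<equiv> \<lambda>n r. int (type_count TYPE('a) n 0 r 1) + int (type_count TYPE('a) n 0 r (- 1))"
  defines "D \<equiv> \<lambda>n r. int (type_count TYPE('a) n 0 r 1) - int (type_count TYPE('a) n 0 r (- 1))"
  shows type_count_odd_rank: "D n (2 * s + 1) = 0"
    and type_count_even_rank: "q ^ s * D n (2 * s) = \<epsilon> ^ s * N n (2 * s)"
proof -
  have q: "q > 0" by (simp add: q_def)
  have \<epsilon>: "\<epsilon> = 1 \<or> \<epsilon> = - 1"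
    unfolding \<epsilon>_def by (rule qchar_cases) simp
  note recs = type_count_Suc[OF le0 disjI1[OF refl]] type_count_Suc[OF le0 disjI2[OF refl]]
  have N_Suc: "N (Suc n) r = q ^ r * N n r
      + (if r \<ge> 1 then q ^ (r - 1) * (q - 1) * N n (r - 1) else 0)
      + (if r \<ge> 2 then q * (q ^ n - q ^ (r - 2)) * N n (r - 2) else 0)" for n r
  proof -
    have "2 * N (Suc n) r = 2 * (q ^ r * N n r
      + (if r \<ge> 1 then q ^ (r - 1) * (q - 1) * N n (r - 1) else 0)
      + (if r \<ge> 2 then q * (q ^ n - q ^ (r - 2)) * N n (r - 2) else 0))"
      using recs[of n r] \<epsilon> unfolding N_def q_def[symmetric] \<epsilon>_def[symmetric]
      by (auto simp: algebra_simps)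
    then show ?thesis by simp
  qed
  have D_Suc: "D (Suc n) r = q ^ r * D n r
      + (if r \<ge> 2 then q * (q ^ n - q ^ (r - 2)) * \<epsilon> * D n (r - 2) else 0)" for n r
  proof -
    have "2 * D (Suc n) r = 2 * (q ^ r * D n r
      + (if r \<ge> 2 then q * (q ^ n - q ^ (r - 2)) * \<epsilon> * D n (r - 2) else 0))"
      using recs[of n r] \<epsilon> unfolding D_def q_def[symmetric] \<epsilon>_def[symmetric]
      by (auto simp: algebra_simps)
    then show ?thesis by simp
  qed
  show "D n (2 * s + 1) = 0"
  proof (induction n arbitrary: s)
    case 0
    then show ?case by (simp add: D_def type_count_0)
  next
    case (Suc n)
    show ?case
      using Suc[of s] Suc[of "s - 1"] by (cases s) (simp_all add: D_Suc)
  qed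
  have ratio: "q ^ (2 * s) * N n (2 * s + 1) = (q ^ n - q ^ (2 * s)) * N n (2 * s)" for n s
  proof (induction n arbitrary: s)
    case 0
    then show ?case by (cases s) (simp_all add: N_def type_count_0)
  next
    case (Suc n)
    show ?case
    proof (cases s)
      case 0
      show ?thesis
      proof -
        have "N n 1 = q ^ n * N n 0 - N n 0"
          using Suc[of 0] by (simp add: algebra_simps)
        then have "N (Suc n) 1 = q * (q ^ n * N n 0 - N n 0) + (q - 1) * N n 0"
          by (simp add: N_Suc)
        then show ?thesis
          using 0 by (simp add: N_Suc algebra_simps)
      qed
    next
      case (Suc t)
      define Q S where "Q = q ^ n" and "S = q ^ (2 * t)"
      have z1: "q\<^sup>2 * S * N n (2 * t + 3) = (Q - q\<^sup>2 * S) * N n (2 * t + 2)"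
        using Suc.IH[of "Suc t"] by (simp add: Q_def S_def power2_eq_square mult_ac eval_nat_numeral)
      have z0: "S * N n (2 * t + 1) = (Q - S) * N n (2 * t)"
        using Suc.IH[of t] by (simp add: Q_def S_def)
      have N1: "N (Suc n) (2 * t + 3) = q ^ 3 * S * N n (2 * t + 3) + q\<^sup>2 * S * (q - 1) * N n (2 * t + 2)
          + q * (Q - q * S) * N n (2 * t + 1)"
        by (subst N_Suc) (simp add: Q_def S_def power2_eq_square mult_ac eval_nat_numeral)
      have N0: "N (Suc n) (2 * t + 2) = q\<^sup>2 * S * N n (2 * t + 2) + q * S * (q - 1) * N n (2 * t + 1)
          + q * (Q - S) * N n (2 * t)"
        by (subst N_Suc) (simp add: Q_def S_def power2_eq_square mult_ac eval_nat_numeral)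
      have "q\<^sup>2 * S * N (Suc n) (2 * t + 3) = q ^ 3 * S * (q\<^sup>2 * S * N n (2 * t + 3))
          + q ^ 4 * S\<^sup>2 * (q - 1) * N n (2 * t + 2) + q ^ 3 * (Q - q * S) * (S * N n (2 * t + 1))"
        unfolding N1 by (simp add: algebra_simps power2_eq_square eval_nat_numeral)
      also have "\<dots> = (q * Q - q\<^sup>2 * S) * (q\<^sup>2 * S * N n (2 * t + 2) + q * (q - 1) * ((Q - S) * N n (2 * t))
          + q * (Q - S) * N n (2 * t))"
        unfolding z1 z0 by (simp add: algebra_simps power2_eq_square eval_nat_numeral)
      also have "\<dots> = (q * Q - q\<^sup>2 * S) * N (Suc n) (2 * t + 2)"
        unfolding N0 z0[symmetric] by (simp add: mult_ac)
      finally show ?thesis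
        using Suc by (simp add: Q_def S_def power2_eq_square mult_ac eval_nat_numeral)
    qed
  qed
  show "q ^ s * D n (2 * s) = \<epsilon> ^ s * N n (2 * s)"
  proof (induction n arbitrary: s)
    case 0
    then show ?case by (cases s) (simp_all add: D_def N_def type_count_0)
  next
    case (Suc n)
    show ?case
    proof (cases s)
      case 0
      then show ?thesis
        using Suc[of 0] by (simp add: D_Suc N_Suc)
    next
      case (Suc t)
      define Q S where "Q = q ^ n" and "S = q ^ (2 * t)"
      have N0: "N (Suc n) (2 * t + 2) = q\<^sup>2 * S * N n (2 * t + 2) + q * (q - 1) * (S * N n (2 * t + 1))
          + q * (Q - S) * N n (2 * t)"
        by (subst N_Suc) (simp add: Q_def S_def power2_eq_square mult_ac eval_nat_numeral)
      have D0: "D (Suc n) (2 * t + 2) = q\<^sup>2 * S * D n (2 * t + 2) + q * (Q - S) * \<epsilon> * D n (2 * t)"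
        by (subst D_Suc) (simp add: Q_def S_def power2_eq_square mult_ac eval_nat_numeral)
      have z0: "S * N n (2 * t + 1) = (Q - S) * N n (2 * t)"
        using ratio[of t n] by (simp add: Q_def S_def)
      have IH1: "q ^ Suc t * D n (2 * t + 2) = \<epsilon> ^ Suc t * N n (2 * t + 2)"
        using Suc.IH[of "Suc t"] by simp
      have IH0: "q ^ t * D n (2 * t) = \<epsilon> ^ t * N n (2 * t)"
        by (rule Suc.IH)
      have "q ^ Suc t * D (Suc n) (2 * t + 2) = q\<^sup>2 * S * (q ^ Suc t * D n (2 * t + 2))
          + q\<^sup>2 * (Q - S) * \<epsilon> * (q ^ t * D n (2 * t))"
        unfolding D0 by (simp add: algebra_simps power2_eq_square)
      also have "\<dots> = \<epsilon> ^ Suc t * (q\<^sup>2 * S * N n (2 * t + 2) + q * (q - 1) * ((Q - S) * N n (2 * t))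
          + q * (Q - S) * N n (2 * t))"
        unfolding IH1 IH0 by (simp add: algebra_simps power2_eq_square)
      also have "\<dots> = \<epsilon> ^ Suc t * N (Suc n) (2 * t + 2)"
        unfolding N0 z0 ..
      finally show ?thesis
        using Suc by simp
    qed
  qed
qed

end

section \<open>The recursion formulas and initial values\<close>

context odd_finite_field
begin

lemma sym0_char_eq_type_count: "sym0_char TYPE('a) \<psi> n k r = type_count TYPE('a) n k r \<psi>"
proof -
  have "{A :: 'a mat. sym_mat n A \<and> vec_space.rank n A = r \<and> (\<forall>i<k. A $$ (i, i) = 0) \<and> has_character n A \<psi>}
      = {A. A \<in> hollow n k \<and> form_type n A r \<psi>}"
    using rank_has_character_iff_form_type by (auto simp: hollow_def)
  then show ?thesis
    by (simp add: sym0_char_def type_count_def)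
qed

lemma sym0_eq_type_count:
  "sym0 TYPE('a) n k r = type_count TYPE('a) n k r 1 + type_count TYPE('a) n k r (- 1)"
proof -
  have rank: "vec_space.rank n A = r \<longleftrightarrow> form_type n A r 1 \<or> form_type n A r (- 1)"
    if "sym_mat n A" for A :: "'a mat"
    using that form_type_exists[OF that] form_type_rank form_type_sign
    unfolding sym_mat_def by metis
  have "{A :: 'a mat. sym_mat n A \<and> vec_space.rank n A = r \<and> (\<forall>i<k. A $$ (i, i) = 0)}
      = {A. A \<in> hollow n k \<and> form_type n A r 1} \<union> {A. A \<in> hollow n k \<and> form_type n A r (- 1)}"
    using rank by (auto simp: hollow_def)
  moreover have "{A :: 'a mat. A \<in> hollow n k \<and> form_type n A r 1} \<inter> {A. A \<in> hollow n k \<and> form_type n A r (- 1)} = {}"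
    using form_type_unique(2)[of _ n r 1 r "- 1"] by (auto simp: hollow_def sym_mat_def)
  ultimately show ?thesis
    unfolding sym0_def type_count_def by (simp add: card_Un_disjoint finite_hollow)
qed

end

lemma sym_num_eq_sym0: "sym_num T n r = sym0 T n 0 r"
  by (simp add: sym_num_def sym0_def)

text \<open>The sign \<open>(-1)\<^sup>t\<close> of the theorem is the quadratic character of a power of \<open>-1\<close>.\<close>

lemma minus_one_power_non_square_indicator:
  fixes m :: nat
  shows "(- 1 :: real) ^ (if is_square ((- 1 :: 'a::field) ^ m) then 0 else 1 :: nat)
    = real_of_int (qchar ((- 1 :: 'a) ^ m))"
  by (simp add: qchar_def quad_char_def)

theorem proposition4p12:
  fixes q n k :: nat
    and \<psi> :: int
  assumes "q = CARD('a::{field,finite})"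
    and "odd q"
    and "n \<ge> 1"
    and "k \<le> n"
    and "\<psi> = 1 \<or> \<psi> = - 1"
  shows
    "(\<forall>r. odd r \<longrightarrow>
        (let t = (if is_square ((- 1 :: 'a) ^ ((r + 1) div 2)) then 0 else 1 :: nat) in
         real (sym0_char TYPE('a) \<psi> (n + 1) (k + 1) (r + 1)) =
           1 / real q * real (sym0_char TYPE('a) \<psi> (n + 1) k (r + 1))
           + (- 1) ^ t * real_of_int \<psi>
             * (1 / 2 * real (sym0 TYPE('a) n k r) + real (sym0_char TYPE('a) \<psi> n k (r + 1)))
             * (real q ^ ((r + 1) div 2) - real q ^ ((r - 1) div 2))))
   \<and> (\<forall>r. even r \<and> r > 0 \<longrightarrow>
        (let t = (if is_square ((- 1 :: 'a) ^ (r div 2)) then 0 else 1 :: nat) in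
         real (sym0_char TYPE('a) \<psi> (n + 1) (k + 1) (r + 1)) =
           1 / real q * real (sym0_char TYPE('a) \<psi> (n + 1) k (r + 1))
           - (- 1) ^ t / 2
             * (real (sym0_char TYPE('a) 1 n k r) - real (sym0_char TYPE('a) (- 1) n k r))
             * (real q ^ (r div 2) - real q ^ (r div 2 - 1))))
   \<and> real (sym0_char TYPE('a) \<psi> (n + 1) (k + 1) 1) = 1 / 2 * real (sym0 TYPE('a) (n + 1) (k + 1) 1)
   \<and> 1 / 2 * real (sym0 TYPE('a) (n + 1) (k + 1) 1) = (real q - 1) / 2 * (\<Sum>i<n - k. real q ^ i)
   \<and> (real q - 1) / 2 * (\<Sum>i<n - k. real q ^ i) = (real q ^ (n - k) - 1) / 2
   \<and> (\<forall>s. real (sym0_char TYPE('a) 1 n 0 (2 * s + 1)) = 1 / 2 * real (sym_num TYPE('a) n (2 * s + 1)))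
   \<and> (\<forall>s. real (sym0_char TYPE('a) 1 n 0 (2 * s)) =
          1 / 2 * ((real q ^ s + real_of_int (quad_char (- 1 :: 'a)) ^ s) / real q ^ s)
          * real (sym_num TYPE('a) n (2 * s)))"
proof -
  interpret odd_finite_field "TYPE('a)"
    using assms(1,2) by unfold_locales simp
  have q1: "q > 1" using card_gt_1[where 'a='a] assms(1) by simp
  define \<epsilon> where "\<epsilon> = qchar (- 1 :: 'a)"
  have \<epsilon>_power: "qchar ((- 1 :: 'a) ^ m) = \<epsilon> ^ m" for m
    by (simp add: qchar_power \<epsilon>_def)
  let ?T = "\<lambda>n k r \<psi>. type_count TYPE('a) n k r \<psi>"
  note to_type_count = sym0_char_eq_type_count sym0_eq_type_count sym_num_eq_sym0
  note excess_even = type_count_excess_even[OF assms(4,5), folded assms(1) \<epsilon>_def]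
  note excess_odd = type_count_excess_odd[OF assms(4,5), folded assms(1) \<epsilon>_def]
  have even_rank: "real (?T (Suc n) (Suc k) (2 * m + 2) \<psi>) = 1 / real q * real (?T (Suc n) k (2 * m + 2) \<psi>)
      + real_of_int (\<epsilon> ^ Suc m) * real_of_int \<psi>
        * (1 / 2 * real (?T n k (2 * m + 1) 1 + ?T n k (2 * m + 1) (- 1)) + real (?T n k (2 * m + 2) \<psi>))
        * (real q ^ Suc m - real q ^ m)" for m
  proof -
    have "2 * (real q * real (?T (Suc n) (Suc k) (2 * m + 2) \<psi>) - real (?T (Suc n) k (2 * m + 2) \<psi>))
      = (real q - 1) * real q ^ Suc m * real_of_int (\<epsilon> ^ Suc m) * real_of_int \<psi> *
        (2 * real (?T n k (2 * m + 2) \<psi>) + real (?T n k (2 * m + 1) 1) + real (?T n k (2 * m + 1) (- 1)))"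
      using arg_cong[OF excess_even[of m], of real_of_int] by simp
    then show ?thesis
      using q1 by (simp add: field_simps)
  qed
  have odd_rank: "real (?T (Suc n) (Suc k) (2 * m + 1) \<psi>) = 1 / real q * real (?T (Suc n) k (2 * m + 1) \<psi>)
      - real_of_int (\<epsilon> ^ m) / 2 * (real (?T n k (2 * m) 1) - real (?T n k (2 * m) (- 1)))
        * (real q ^ m - real q ^ (m - 1))" if "m > 0" for m
  proof -
    have "2 * (real q * real (?T (Suc n) (Suc k) (2 * m + 1) \<psi>) - real (?T (Suc n) k (2 * m + 1) \<psi>))
      = - ((real q - 1) * real q ^ m * real_of_int (\<epsilon> ^ m) *
        (real (?T n k (2 * m) 1) - real (?T n k (2 * m) (- 1))))"
      using arg_cong[OF excess_odd[of m], of real_of_int] by simp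
    moreover obtain p where "m = Suc p"
      using \<open>m > 0\<close> by (cases m) auto
    ultimately show ?thesis
      using q1 by (simp add: field_simps)
  qed
  have rank_1: "real (?T (Suc n) (Suc k) 1 \<phi>) = (real q ^ (n - k) - 1) / 2" if "\<phi> = 1 \<or> \<phi> = - 1" for \<phi>
    using arg_cong[OF type_count_rank_1[OF that, of "Suc k" "Suc n", folded assms(1)], of real_of_int]
      assms(4) by simp
  have geometric: "(real q - 1) * (\<Sum>i<n - k. real q ^ i) = real q ^ (n - k) - 1"
    using q1 by (simp add: geometric_sum)
  have odd_full: "real (?T n 0 (2 * s + 1) 1) = 1 / 2 * real (?T n 0 (2 * s + 1) 1 + ?T n 0 (2 * s + 1) (- 1))" for s
    using type_count_odd_rank[of n s] by simp
  have even_full: "real (?T n 0 (2 * s) 1) = 1 / 2 * ((real q ^ s + real_of_int \<epsilon> ^ s) / real q ^ s)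
      * real (?T n 0 (2 * s) 1 + ?T n 0 (2 * s) (- 1))" for s
  proof -
    have "real q ^ s * (real (?T n 0 (2 * s) 1) - real (?T n 0 (2 * s) (- 1)))
        = real_of_int \<epsilon> ^ s * (real (?T n 0 (2 * s) 1) + real (?T n 0 (2 * s) (- 1)))"
      using arg_cong[OF type_count_even_rank[of s n, folded assms(1) \<epsilon>_def], of real_of_int] by simp
    then show ?thesis
      using q1 by (simp add: field_simps)
  qed
  have "quad_char (- 1 :: 'a) = \<epsilon>"
    by (simp add: \<epsilon>_def qchar_def)
  show ?thesis
    unfolding Let_def minus_one_power_non_square_indicator \<epsilon>_power to_type_count \<open>quad_char (- 1 :: 'a) = \<epsilon>\<close>
  proof (intro conjI allI impI)
    fix r :: nat assume "odd r"
    then obtain m where r: "r = 2 * m + 1" by (rule oddE)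
    show "real (?T (n + 1) (k + 1) (r + 1) \<psi>) = 1 / real q * real (?T (n + 1) k (r + 1) \<psi>)
      + real_of_int (\<epsilon> ^ ((r + 1) div 2)) * real_of_int \<psi>
        * (1 / 2 * real (?T n k r 1 + ?T n k r (- 1)) + real (?T n k (r + 1) \<psi>))
        * (real q ^ ((r + 1) div 2) - real q ^ ((r - 1) div 2))"
      using even_rank[of m] by (simp add: r)
  next
    fix r :: nat assume "even r \<and> 0 < r"
    then obtain m where "r = 2 * m" "m > 0" by (auto elim: evenE)
    then show "real (?T (n + 1) (k + 1) (r + 1) \<psi>) = 1 / real q * real (?T (n + 1) k (r + 1) \<psi>)
      - real_of_int (\<epsilon> ^ (r div 2)) / 2 * (real (?T n k r 1) - real (?T n k r (- 1)))
        * (real q ^ (r div 2) - real q ^ (r div 2 - 1))"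
      using odd_rank[of m] by simp
  next
    show "real (?T (n + 1) (k + 1) 1 \<psi>) = 1 / 2 * real (?T (n + 1) (k + 1) 1 1 + ?T (n + 1) (k + 1) 1 (- 1))"
      using rank_1[OF assms(5)] rank_1[of 1] rank_1[of "- 1"] by simp
    show "1 / 2 * real (?T (n + 1) (k + 1) 1 1 + ?T (n + 1) (k + 1) 1 (- 1)) = (real q - 1) / 2 * (\<Sum>i<n - k. real q ^ i)"
      using rank_1[of 1] rank_1[of "- 1"] geometric by simp
    show "(real q - 1) / 2 * (\<Sum>i<n - k. real q ^ i) = (real q ^ (n - k) - 1) / 2"
      using geometric by simp
  next
    fix s
    show "real (?T n 0 (2 * s + 1) 1) = 1 / 2 * real (?T n 0 (2 * s + 1) 1 + ?T n 0 (2 * s + 1) (- 1))"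
      by (rule odd_full)
    show "real (?T n 0 (2 * s) 1) = 1 / 2 * ((real q ^ s + real_of_int \<epsilon> ^ s) / real q ^ s)
      * real (?T n 0 (2 * s) 1 + ?T n 0 (2 * s) (- 1))"
      by (rule even_full)
  qed
qed

end
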